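(* Let $S$ be a Boolean ample monoid with set of idempotents $\mathsf{E}(S)$. Suppose that for every prime filter $F$ of the Boolean algebra $\mathsf{E}(S)$ and all $a,b \in S$ such that $a^{\ast}b^{\ast} \in F$ there exist non-zero elements $c,d \in S$ such that: (1) there exists $a_1 \in S$ with $a_1 \leq a$, $a_1^{\ast} \in F$, $a^{\ast} \in F$ and $a_1^{+} \leq c^{\ast}$, and there exists $b_1 \in S$ with $b_1 \leq b$, $b_1^{\ast} \in F$, $b^{\ast} \in F$ and $b_1^{+} \leq d^{\ast}$; and (2) there is an element $e \in F$ such that $cae = dbe$. Then $S$ can be embedded as a full submonoid of a Boolean inverse monoid $T$ in such a way that every non-zero element of $T$ is a finite join of elements of the form $a^{-1}b$ where $a,b \in S$. That is, there are a Boolean inverse monoid $T$ and an injective monoid homomorphism $\iota \colon S \to T$ with $\mathsf{E}(T) \subseteq \iota(S)$ such that every non-zero $t \in T$ can be written $t = \bigvee_{i=1}^{n} \iota(a_i)^{-1}\iota(b_i)$ for some $n \geq 1$ and $a_i,b_i \in S$.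
   Context: An ample semigroup (monoid) is a semigroup (monoid) equipped with two unary operations $a \mapsto a^{\ast}$, $a \mapsto a^{+}$ satisfying, for all elements: (A1) $(s^{\ast})^{\ast}=s^{\ast}$, $(s^{+})^{+}=s^{+}$, $(s^{\ast})^{+}=s^{\ast}$, $(s^{+})^{\ast}=s^{+}$; (A2) $(s^{\ast}t^{\ast})^{\ast}=s^{\ast}t^{\ast}$, $(s^{+}t^{+})^{+}=s^{+}t^{+}$; (A3) $s^{\ast}t^{\ast}=t^{\ast}s^{\ast}$, $s^{+}t^{+}=t^{+}s^{+}$; (A4) $ss^{\ast}=s$, $s^{+}s=s$; (A5) $(st)^{\ast}=(s^{\ast}t)^{\ast}$, $(st)^{+}=(st^{+})^{+}$; (A6) $t^{\ast}s=s(ts)^{\ast}$, $st^{+}=(st^{+})^{+}s$; (A7) if $ac=bc$ then $ac^{+}=bc^{+}$, and if $ca=cb$ then $c^{\ast}a=c^{\ast}b$. A restriction monoid is a monoid with such operations satisfying (A1)--(A6). Elements of the form $a^{\ast}$ or $a^{+}$ are called projections; in an ample monoid the projections are exactly the idempotents. $\mathsf{E}(S)$ denotes the set of idempotents of $S$. The natural partial order on a restriction monoid is: $a \leq b$ iff $a = ba^{\ast}$. Elements $a,b$ are compatible if $ab^{\ast}=ba^{\ast}$ and $a^{+}b=b^{+}a$. A Boolean restriction monoid is a restriction monoid with zero $0$ in which every pair of compatible elements has a join (with respect to the natural partial order), multiplication distributes over such joins from both sides, and the set of projections forms a Boolean algebra under the natural partial order (with bottom element $0$). A Boolean ample monoid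 is a Boolean restriction monoid that is ample. A Boolean inverse monoid is an inverse monoid which, with $a^{\ast}=a^{-1}a$ and $a^{+}=aa^{-1}$, is a Boolean restriction monoid. All joins are with respect to the natural partial order. A filter in a Boolean algebra is a non-empty upward closed subset closed under binary meets; it is proper if it does not contain $0$; a proper filter $F$ is prime if $x \vee y \in F$ implies $x \in F$ or $y \in F$. *)

theory Defs
  imports "HOL-Algebra.Group" "HOL-Algebra.Lattice"
begin

section \<open>Boolean algebras and prime filters\<close>

locale boolean_lattice = bounded_lattice +
  assumes meet_join_distrib:
    "\<lbrakk>x \<in> carrier L; y \<in> carrier L; z \<in> carrier L\<rbrakk>
      \<Longrightarrow> x \<sqinter> (y \<squnion> z) = (x \<sqinter> y) \<squnion> (x \<sqinter> z)"
    and complement_exists: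
    "x \<in> carrier L \<Longrightarrow> \<exists>y\<in>carrier L. x \<sqinter> y = \<bottom> \<and> x \<squnion> y = \<top>"

definition order_filter :: "('a, 'm) gorder_scheme \<Rightarrow> 'a set \<Rightarrow> bool" where
  "order_filter L F \<longleftrightarrow> F \<subseteq> carrier L \<and> F \<noteq> {} \<and>
     (\<forall>x\<in>F. \<forall>y\<in>carrier L. x \<sqsubseteq>\<^bsub>L\<^esub> y \<longrightarrow> y \<in> F) \<and>
     (\<forall>x\<in>F. \<forall>y\<in>F. x \<sqinter>\<^bsub>L\<^esub> y \<in> F)"

definition prime_filter :: "('a, 'm) gorder_scheme \<Rightarrow> 'a set \<Rightarrow> bool" where
  "prime_filter L F \<longleftrightarrow> order_filter L F \<and> \<bottom>\<^bsub>L\<^esub> \<notin> F \<and>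
     (\<forall>x\<in>carrier L. \<forall>y\<in>carrier L. x \<squnion>\<^bsub>L\<^esub> y \<in> F \<longrightarrow> x \<in> F \<or> y \<in> F)"

section \<open>Restriction monoids and ample monoids\<close>

definition idempotents :: "('a, 'm) monoid_scheme \<Rightarrow> 'a set" where
  "idempotents M = {e \<in> carrier M. e \<otimes>\<^bsub>M\<^esub> e = e}"

definition natural_order :: "('a, 'm) monoid_scheme \<Rightarrow> ('a \<Rightarrow> 'a) \<Rightarrow> 'a gorder" where
  "natural_order M star =
     \<lparr>carrier = carrier M, eq = (=), le = (\<lambda>a b. a = b \<otimes>\<^bsub>M\<^esub> star a)\<rparr>"

definition natural_order_on :: "('a, 'm) monoid_scheme \<Rightarrow> ('a \<Rightarrow> 'a) \<Rightarrow> 'a set \<Rightarrow> 'a gorder" where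
  "natural_order_on M star E = (natural_order M star)\<lparr>carrier := E\<rparr>"

definition is_join :: "('a, 'm) monoid_scheme \<Rightarrow> ('a \<Rightarrow> 'a) \<Rightarrow> 'a set \<Rightarrow> 'a \<Rightarrow> bool" where
  "is_join M star A c \<longleftrightarrow>
     least (natural_order M star) c (Upper (natural_order M star) A)"

locale restriction_monoid = monoid M for M (structure) +
  fixes star :: "'a \<Rightarrow> 'a" and pls :: "'a \<Rightarrow> 'a"
  assumes star_closed: "s \<in> carrier M \<Longrightarrow> star s \<in> carrier M"
    and pls_closed: "s \<in> carrier M \<Longrightarrow> pls s \<in> carrier M"
    and A1: "s \<in> carrier M \<Longrightarrow> star (star s) = star s"
            "s \<in> carrier M \<Longrightarrow> pls (pls s) = pls s"
            "s \<in> carrier M \<Longrightarrow> pls (star s) = star s"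
            "s \<in> carrier M \<Longrightarrow> star (pls s) = pls s"
    and A2: "\<lbrakk>s \<in> carrier M; t \<in> carrier M\<rbrakk> \<Longrightarrow> star (star s \<otimes> star t) = star s \<otimes> star t"
            "\<lbrakk>s \<in> carrier M; t \<in> carrier M\<rbrakk> \<Longrightarrow> pls (pls s \<otimes> pls t) = pls s \<otimes> pls t"
    and A3: "\<lbrakk>s \<in> carrier M; t \<in> carrier M\<rbrakk> \<Longrightarrow> star s \<otimes> star t = star t \<otimes> star s"
            "\<lbrakk>s \<in> carrier M; t \<in> carrier M\<rbrakk> \<Longrightarrow> pls s \<otimes> pls t = pls t \<otimes> pls s"
    and A4: "s \<in> carrier M \<Longrightarrow> s \<otimes> star s = s"
            "s \<in> carrier M \<Longrightarrow> pls s \<otimes> s = s"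
    and A5: "\<lbrakk>s \<in> carrier M; t \<in> carrier M\<rbrakk> \<Longrightarrow> star (s \<otimes> t) = star (star s \<otimes> t)"
            "\<lbrakk>s \<in> carrier M; t \<in> carrier M\<rbrakk> \<Longrightarrow> pls (s \<otimes> t) = pls (s \<otimes> pls t)"
    and A6: "\<lbrakk>s \<in> carrier M; t \<in> carrier M\<rbrakk> \<Longrightarrow> star t \<otimes> s = s \<otimes> star (t \<otimes> s)"
            "\<lbrakk>s \<in> carrier M; t \<in> carrier M\<rbrakk> \<Longrightarrow> s \<otimes> pls t = pls (s \<otimes> pls t) \<otimes> s"
begin

definition projections :: "'a set" where
  "projections = star ` carrier M \<union> pls ` carrier M"

definition compatible :: "'a \<Rightarrow> 'a \<Rightarrow> bool" where
  "compatible a b \<longleftrightarrow> a \<otimes> star b = b \<otimes> star a \<and> pls a \<otimes> b = pls b \<otimes> a"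

end

locale ample_monoid = restriction_monoid +
  assumes A7: "\<lbrakk>a \<in> carrier M; b \<in> carrier M; c \<in> carrier M; a \<otimes> c = b \<otimes> c\<rbrakk>
                \<Longrightarrow> a \<otimes> pls c = b \<otimes> pls c"
              "\<lbrakk>a \<in> carrier M; b \<in> carrier M; c \<in> carrier M; c \<otimes> a = c \<otimes> b\<rbrakk>
                \<Longrightarrow> star c \<otimes> a = star c \<otimes> b"

locale boolean_restriction_monoid = restriction_monoid +
  fixes zero :: "'a"
  assumes zero_closed: "zero \<in> carrier M"
    and zero_mult: "s \<in> carrier M \<Longrightarrow> zero \<otimes> s = zero"
                   "s \<in> carrier M \<Longrightarrow> s \<otimes> zero = zero"
    and compatible_join_exists:
      "\<lbrakk>a \<in> carrier M; b \<in> carrier M; compatible a b\<rbrakk> \<Longrightarrow> \<exists>c. is_join M star {a, b} c"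
    and mult_join_distrib:
      "\<lbrakk>a \<in> carrier M; b \<in> carrier M; s \<in> carrier M; compatible a b; is_join M star {a, b} c\<rbrakk>
        \<Longrightarrow> is_join M star {s \<otimes> a, s \<otimes> b} (s \<otimes> c)"
      "\<lbrakk>a \<in> carrier M; b \<in> carrier M; s \<in> carrier M; compatible a b; is_join M star {a, b} c\<rbrakk>
        \<Longrightarrow> is_join M star {a \<otimes> s, b \<otimes> s} (c \<otimes> s)"
    and projections_boolean: "boolean_lattice (natural_order_on M star projections)"
    and zero_bottom: "least (natural_order_on M star projections) zero projections"

locale boolean_ample_monoid = boolean_restriction_monoid + ample_monoid

section \<open>Inverse monoids\<close>

locale inverse_monoid = monoid M for M (structure) +
  assumes ex1_inverse:
    "a \<in> carrier M \<Longrightarrow> \<exists>!b. b \<in> carrier M \<and> a \<otimes> b \<otimes> a = a \<and> b \<otimes> a \<otimes> b = b"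

text \<open>The inverse in the sense of inverse semigroups; \<^const>\<open>m_inv\<close> is the group-theoretic
  inverse and is only meaningful on units.\<close>

definition sg_inv :: "('a, 'm) monoid_scheme \<Rightarrow> 'a \<Rightarrow> 'a" where
  "sg_inv M a = (THE b. b \<in> carrier M \<and> a \<otimes>\<^bsub>M\<^esub> b \<otimes>\<^bsub>M\<^esub> a = a \<and> b \<otimes>\<^bsub>M\<^esub> a \<otimes>\<^bsub>M\<^esub> b = b)"

definition inv_star :: "('a, 'm) monoid_scheme \<Rightarrow> 'a \<Rightarrow> 'a" where
  "inv_star M a = sg_inv M a \<otimes>\<^bsub>M\<^esub> a"

definition inv_pls :: "('a, 'm) monoid_scheme \<Rightarrow> 'a \<Rightarrow> 'a" where
  "inv_pls M a = a \<otimes>\<^bsub>M\<^esub> sg_inv M a"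

locale boolean_inverse_monoid =
  inverse_monoid M + boolean_restriction_monoid M "inv_star M" "inv_pls M" zero
  for M (structure) and zero

end

theory Submission
  imports Defs
begin

text \<open>Right multiplication by \<open>s\<close> acts on germs of formal fractions \<open>z\<inverse>w\<close> at prime filters by
  \<open>z\<inverse>w \<mapsto> (zs)\<inverse>w\<close>. This represents \<open>S\<close> faithfully by partial bijections: injectivity comes from
  cancellation (A7), and the hypothesis of the theorem, a pointwise left Ore condition, both makes
  equality of germs transitive and makes the range of \<open>s\<close> equal to the domain of \<open>s\<^sup>*\<close>. The monoid
  \<open>T\<close> consists of the partial bijections that are finite unions of composites \<open>a\<inverse>b\<close>; it is closed
  under composition because the Ore condition turns every \<open>ba\<inverse>\<close> locally into some \<open>c\<inverse>d\<close>, and the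
  prime filter theorem makes finitely many such local pieces suffice. Each element of \<open>T\<close> is encoded
  by one chosen list of pairs \<open>(a, b)\<close> describing it.\<close>

section \<open>Monoids of biunique relations\<close>

text \<open>Letting elements act on prime filters alone (\<open>pull\<close> and \<open>push\<close>
  below) would not be faithful. If the only projections are \<open>zero\<close> and
  \<open>\<one>\<close>, there is a single prime filter, while the nonzero elements form a
  cancellative monoid with common left multiples, and \<open>T\<close> has to be its group of left
  fractions with a zero adjoined. Hence a point carries a fraction besides its filter. The numerator
  \<open>w\<close> is never changed by the action, yet it cannot be dropped: with denominators
  alone, common left multiples would identify all points of that example. Two elements are compared
  at points with \<open>z = w = \<one>\<close>; there the condition on numerators forces both
  multipliers of an equality of germs to agree, so that cancellation applies. Acting on the
  denominator makes \<open>s\<close> act as left multiplication by its inverse, which turns products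
  in \<open>S\<close> into relational composites read from left to right. Among partial bijections
  the natural order is inclusion, so compatible joins are unions. Complements are the exception:
  they are taken from \<open>S\<close>, because a finite union of fractions that is a partial
  identity is the action of a projection.\<close>

definition biunique :: "'x rel \<Rightarrow> bool" where
  "biunique r \<longleftrightarrow> single_valued r \<and> single_valued (r\<inverse>)"

lemma biuniqueD:
  assumes "biunique r"
  shows "\<lbrakk>(x, y) \<in> r; (x, y') \<in> r\<rbrakk> \<Longrightarrow> y = y'" "\<lbrakk>(x, y) \<in> r; (x', y) \<in> r\<rbrakk> \<Longrightarrow> x = x'"
  using assms unfolding biunique_def single_valued_def by auto

lemma biuniqueI:
  assumes "\<And>x y y'. \<lbrakk>(x, y) \<in> r; (x, y') \<in> r\<rbrakk> \<Longrightarrow> y = y'"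
    and "\<And>x x' y. \<lbrakk>(x, y) \<in> r; (x', y) \<in> r\<rbrakk> \<Longrightarrow> x = x'"
  shows "biunique r"
  using assms unfolding biunique_def single_valued_def by auto

lemma biunique_relcomp: "\<lbrakk>biunique r; biunique s\<rbrakk> \<Longrightarrow> biunique (r O s)"
  unfolding biunique_def by (simp add: converse_relcomp single_valued_relcomp)

lemma biunique_converse: "biunique r \<Longrightarrow> biunique (r\<inverse>)"
  unfolding biunique_def by simp

lemma biunique_converse_relcomp: "biunique r \<Longrightarrow> r\<inverse> O r = Id_on (Range r)"
  by (auto dest: biuniqueD)

lemma biunique_relcomp_converse: "biunique r \<Longrightarrow> r O r\<inverse> = Id_on (Domain r)"
  by (auto dest: biuniqueD)

text \<open>With the next lemma this is (A6) for relations. A point of \<open>Range (t O s)\<close>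
  has a single preimage under the injective \<open>s\<close>, so restricting targets amounts to
  restricting sources. The companion rests on \<open>s\<close> being single-valued.\<close>

lemma Id_on_Range_relcomp:
  assumes "biunique s"
  shows "Id_on (Range t) O s = s O Id_on (Range (t O s))"
  by (auto dest: biuniqueD[OF assms])

lemma relcomp_Id_on_Domain:
  assumes "biunique s"
  shows "s O Id_on (Domain t) = Id_on (Domain (s O Id_on (Domain t))) O s"
proof -
  have "p \<in> s O Id_on (Domain t) \<longleftrightarrow> p \<in> Id_on (Domain (s O Id_on (Domain t))) O s" for p
    using biuniqueD(1)[OF assms] by (cases p) (auto simp: relcomp_unfold Id_on_iff Domain_unfold)
  then show ?thesis by (rule Set.set_eqI)
qed

lemma biunique_sandwich: "biunique r \<Longrightarrow> r O r\<inverse> O r = r"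
  by (auto dest: biuniqueD)

text \<open>Each equation gives one inclusion: a pair of \<open>r\<close> is also a path through
  \<open>r\<close>, \<open>s\<close>, \<open>r\<close>, and biuniqueness forces both outer steps to
  be that pair, so the middle step is its reversal.\<close>

lemma biunique_inverse_unique:
  assumes r: "biunique r" and s: "biunique s" and rsr: "r O s O r = r" and srs: "s O r O s = s"
  shows "s = r\<inverse>"
proof -
  have sub: "t\<inverse> \<subseteq> u" if "biunique t" "t O u O t = t" for t u :: "'a rel"
  proof clarify
    fix x y assume xy: "(x, y) \<in> t"
    then have "(x, y) \<in> t O u O t" using that(2) by simp
    then obtain k m where "(x, k) \<in> t" "(k, m) \<in> u" "(m, y) \<in> t" by auto
    then show "(y, x) \<in> u" using biuniqueD[OF that(1)] xy by blast
  qed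
  from sub[OF r rsr] sub[OF s srs] show ?thesis by auto
qed

lemma biunique_idempotent: "\<lbrakk>biunique r; r O r = r\<rbrakk> \<Longrightarrow> r \<subseteq> Id"
proof
  fix p assume r: "biunique r" "r O r = r" and "p \<in> r"
  then have "p \<in> r O r" by simp
  then obtain x m y where "p = (x, y)" "(x, m) \<in> r" "(m, y) \<in> r" by auto
  with \<open>p \<in> r\<close> show "p \<in> Id" using biuniqueD[OF r(1)] by blast
qed

text \<open>The carrier is kept abstract because \<open>T\<close> will consist of lists that merely
  describe relations. The image of \<open>\<one>\<close> may be a proper part of the identity
  relation, so complements are formed below \<open>rep \<one>\<close>; unions are asked for only
  where they stay biunique.\<close>

locale biunique_representation = monoid T for T (structure) +
  fixes rep :: "'a \<Rightarrow> 'x rel" and zero :: 'a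
  assumes inj_rep: "inj_on rep (carrier T)"
    and rep_mult: "\<lbrakk>x \<in> carrier T; y \<in> carrier T\<rbrakk> \<Longrightarrow> rep (x \<otimes> y) = rep x O rep y"
    and rep_biunique: "x \<in> carrier T \<Longrightarrow> biunique (rep x)"
    and rep_converse: "x \<in> carrier T \<Longrightarrow> \<exists>y\<in>carrier T. rep y = (rep x)\<inverse>"
    and zero_closed: "zero \<in> carrier T"
    and rep_zero: "rep zero = {}"
    and rep_union: "\<lbrakk>x \<in> carrier T; y \<in> carrier T; biunique (rep x \<union> rep y)\<rbrakk>
          \<Longrightarrow> \<exists>z\<in>carrier T. rep z = rep x \<union> rep y"
    and rep_complement: "\<lbrakk>x \<in> carrier T; rep x \<subseteq> Id\<rbrakk>
          \<Longrightarrow> \<exists>y\<in>carrier T. rep x \<inter> rep y = {} \<and> rep x \<union> rep y = rep \<one>"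
begin

lemma rep_eqD: "\<lbrakk>rep x = rep y; x \<in> carrier T; y \<in> carrier T\<rbrakk> \<Longrightarrow> x = y"
  using inj_rep by (auto dest: inj_onD)

lemma rep_one_subset_Id: "rep \<one> \<subseteq> Id"
  using biunique_idempotent[of "rep \<one>"] rep_biunique rep_mult[of \<one> \<one>] by simp

lemma inverse_rep:
  assumes "x \<in> carrier T" "y \<in> carrier T"
  shows "x \<otimes> y \<otimes> x = x \<and> y \<otimes> x \<otimes> y = y \<longleftrightarrow> rep y = (rep x)\<inverse>"
proof
  assume "x \<otimes> y \<otimes> x = x \<and> y \<otimes> x \<otimes> y = y"
  then have "rep (x \<otimes> y \<otimes> x) = rep x" "rep (y \<otimes> x \<otimes> y) = rep y" by auto
  then show "rep y = (rep x)\<inverse>"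
    using assms by (intro biunique_inverse_unique) (auto simp: rep_mult rep_biunique O_assoc)
next
  assume r: "rep y = (rep x)\<inverse>"
  have "rep (x \<otimes> y \<otimes> x) = rep x"
    using assms biunique_sandwich[OF rep_biunique[of x]] by (simp add: rep_mult r O_assoc)
  moreover have "rep (y \<otimes> x \<otimes> y) = rep y"
    using assms biunique_sandwich[OF biunique_converse[OF rep_biunique[of x]]]
    by (simp add: rep_mult r O_assoc)
  ultimately show "x \<otimes> y \<otimes> x = x \<and> y \<otimes> x \<otimes> y = y"
    using assms rep_eqD by simp
qed

sublocale inverse_monoid T
proof
  fix x assume x: "x \<in> carrier T"
  then obtain y where y: "y \<in> carrier T" "rep y = (rep x)\<inverse>" using rep_converse by blast
  then show "\<exists>!y. y \<in> carrier T \<and> x \<otimes> y \<otimes> x = x \<and> y \<otimes> x \<otimes> y = y"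
    using x inverse_rep rep_eqD by metis
qed

lemma sg_inv_rep:
  assumes "x \<in> carrier T"
  shows "sg_inv T x \<in> carrier T" "rep (sg_inv T x) = (rep x)\<inverse>"
  using theI'[OF ex1_inverse[OF assms]] inverse_rep[OF assms] unfolding sg_inv_def by blast+

lemma inv_star_rep:
  assumes "x \<in> carrier T"
  shows "inv_star T x \<in> carrier T" "rep (inv_star T x) = Id_on (Range (rep x))"
  using assms unfolding inv_star_def
  by (simp_all add: sg_inv_rep rep_mult biunique_converse_relcomp rep_biunique)

lemma inv_pls_rep:
  assumes "x \<in> carrier T"
  shows "inv_pls T x \<in> carrier T" "rep (inv_pls T x) = Id_on (Domain (rep x))"
  using assms unfolding inv_pls_def
  by (simp_all add: sg_inv_rep rep_mult biunique_relcomp_converse rep_biunique)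

text \<open>If \<open>rep x \<subseteq> rep y\<close>, injectivity of \<open>rep y\<close> shows
  that cutting it down to the range of \<open>rep x\<close> leaves nothing but
  \<open>rep x\<close>.\<close>

lemma natural_order_rep:
  assumes "x \<in> carrier T" "y \<in> carrier T"
  shows "x = y \<otimes> inv_star T x \<longleftrightarrow> rep x \<subseteq> rep y"
proof
  assume "x = y \<otimes> inv_star T x"
  then have "rep x = rep y O Id_on (Range (rep x))"
    using assms inv_star_rep rep_mult by metis
  then show "rep x \<subseteq> rep y" by auto
next
  assume "rep x \<subseteq> rep y"
  then have "rep x = rep y O Id_on (Range (rep x))"
    using biuniqueD[OF rep_biunique[OF assms(2)]] by auto blast
  then show "x = y \<otimes> inv_star T x"
    using assms inv_star_rep rep_mult by (intro rep_eqD) auto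
qed

lemma is_join_rep:
  assumes "A \<subseteq> carrier T" "z \<in> carrier T" "rep z = (\<Union>x\<in>A. rep x)"
  shows "is_join T (inv_star T) A z"
  using assms unfolding is_join_def least_def Upper_def natural_order_def
  by (auto simp: natural_order_rep subset_iff)

lemma rep_subset_IdI:
  assumes "x \<in> carrier T" "x \<otimes> x = x"
  shows "rep x \<subseteq> Id"
  using biunique_idempotent rep_biunique rep_mult assms by metis

sublocale restriction_monoid T "inv_star T" "inv_pls T"
proof
  note reps = rep_mult inv_star_rep inv_pls_rep
  fix s assume s: "s \<in> carrier T"
  show "inv_star T s \<in> carrier T" "inv_pls T s \<in> carrier T"
    by (simp_all add: s reps)
  show "inv_star T (inv_star T s) = inv_star T s" "inv_pls T (inv_pls T s) = inv_pls T s"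
    "inv_pls T (inv_star T s) = inv_star T s" "inv_star T (inv_pls T s) = inv_pls T s"
    by (rule rep_eqD; use s in \<open>auto simp: reps\<close>)+
  show "s \<otimes> inv_star T s = s" "inv_pls T s \<otimes> s = s"
    by (rule rep_eqD; use s in \<open>auto simp: reps\<close>)+
  fix t assume t: "t \<in> carrier T"
  show "inv_star T (inv_star T s \<otimes> inv_star T t) = inv_star T s \<otimes> inv_star T t"
    "inv_pls T (inv_pls T s \<otimes> inv_pls T t) = inv_pls T s \<otimes> inv_pls T t"
    "inv_star T s \<otimes> inv_star T t = inv_star T t \<otimes> inv_star T s"
    "inv_pls T s \<otimes> inv_pls T t = inv_pls T t \<otimes> inv_pls T s"
    by (rule rep_eqD; use s t in \<open>auto simp: reps\<close>)+
  show "inv_star T (s \<otimes> t) = inv_star T (inv_star T s \<otimes> t)"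
    "inv_pls T (s \<otimes> t) = inv_pls T (s \<otimes> inv_pls T t)"
    by (rule rep_eqD; use s t in \<open>auto simp: reps\<close>)+
  show "inv_star T t \<otimes> s = s \<otimes> inv_star T (t \<otimes> s)"
    "s \<otimes> inv_pls T t = inv_pls T (s \<otimes> inv_pls T t) \<otimes> s"
    by (rule rep_eqD; use s t Id_on_Range_relcomp[OF rep_biunique, of s "rep t"]
        relcomp_Id_on_Domain[OF rep_biunique, of s "rep t"] in \<open>simp add: reps\<close>)+
qed

section \<open>Joins and the Boolean algebra of partial identities\<close>

lemma projections_rep: "projections = {x \<in> carrier T. rep x \<subseteq> Id}"
proof -
  have "inv_star T x = x" if "x \<in> carrier T" "rep x \<subseteq> Id" for x
    using that by (intro rep_eqD) (auto simp: inv_star_rep)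
  then show ?thesis
    unfolding projections_def by (auto simp: inv_star_rep inv_pls_rep image_iff) metis
qed

text \<open>The two equations of compatibility say that both relations agree over common range
  points and over common domain points, which keeps the union injective and single-valued.\<close>

lemma compatible_biunique_union:
  assumes "x \<in> carrier T" "y \<in> carrier T" "compatible x y"
  shows "biunique (rep x \<union> rep y)"
proof -
  have "rep (x \<otimes> inv_star T y) = rep (y \<otimes> inv_star T x)"
    "rep (inv_pls T x \<otimes> y) = rep (inv_pls T y \<otimes> x)"
    using assms(3) unfolding compatible_def by auto
  then have 1: "rep x O Id_on (Range (rep y)) = rep y O Id_on (Range (rep x))"
    and 2: "Id_on (Domain (rep x)) O rep y = Id_on (Domain (rep y)) O rep x"
    using assms by (auto simp: rep_mult inv_star_rep inv_pls_rep)
  have 3: "(u, v) \<in> rep y" if "(u, v) \<in> rep x" "(u', v) \<in> rep y" for u u' v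
    using that 1 by (auto simp: set_eq_iff relcomp_unfold Id_on_iff)
  have 4: "(u, v) \<in> rep x" if "(u, v) \<in> rep y" "(u, v') \<in> rep x" for u v v'
    using that 2 by (auto simp: set_eq_iff relcomp_unfold Id_on_iff)
  note x = biuniqueD[OF rep_biunique[OF assms(1)]] and y = biuniqueD[OF rep_biunique[OF assms(2)]]
  show ?thesis
  proof (rule biuniqueI)
    show "v = v'" if "(u, v) \<in> rep x \<union> rep y" "(u, v') \<in> rep x \<union> rep y" for u v v'
      using that x(1)[of u v v'] y(1)[of u v v'] 4[of u v v'] 4[of u v' v] by blast
    show "u = u'" if "(u, v) \<in> rep x \<union> rep y" "(u', v) \<in> rep x \<union> rep y" for u u' v
      using that x(2)[of u v u'] y(2)[of u v u'] 3[of u v u'] 3[of u' v u] by blast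
  qed
qed

text \<open>The union is a join, and joins are unique by antisymmetry. Distributivity then reduces
  to that of composition over union.\<close>

lemma is_join_pair_rep:
  assumes "x \<in> carrier T" "y \<in> carrier T" "compatible x y" "is_join T (inv_star T) {x, y} z"
  shows "z \<in> carrier T" "rep z = rep x \<union> rep y"
proof -
  obtain u where u: "u \<in> carrier T" "rep u = rep x \<union> rep y"
    using rep_union[OF assms(1,2)] compatible_biunique_union[OF assms(1-3)] by blast
  then have "is_join T (inv_star T) {x, y} u" using assms by (intro is_join_rep) auto
  with assms(4) have zu: "z \<in> carrier T" "z = u \<otimes> inv_star T z" "u = z \<otimes> inv_star T u"
    unfolding is_join_def least_def Upper_def natural_order_def by auto
  then show "z \<in> carrier T" "rep z = rep x \<union> rep y"
    using u natural_order_rep[of z u] natural_order_rep[of u z] by blast+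
qed

text \<open>Composition of partial identities is intersection, so the lattice is one of sets, with
  products as meets and unions as joins; complements come from
  \<open>rep_complement\<close>.\<close>

lemma boolean_lattice_projections: "boolean_lattice (natural_order_on T (inv_star T) projections)"
    (is "boolean_lattice ?L")
proof -
  have carrier: "carrier ?L = {x \<in> carrier T. rep x \<subseteq> Id}"
    by (simp add: natural_order_on_def projections_rep)
  have eq: "eq ?L = (=)"
    by (simp add: natural_order_on_def natural_order_def)
  have le: "x \<sqsubseteq>\<^bsub>?L\<^esub> y \<longleftrightarrow> rep x \<subseteq> rep y" if "x \<in> carrier ?L" "y \<in> carrier ?L" for x y
    using that natural_order_rep by (simp add: natural_order_on_def natural_order_def projections_rep)
  have eqI: "x = y" if "x \<in> carrier ?L" "y \<in> carrier ?L" "rep x = rep y" for x y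
    using that rep_eqD by (simp add: carrier)
  interpret partial_order ?L
  proof
    show "x .=\<^bsub>?L\<^esub> y" if "x \<sqsubseteq>\<^bsub>?L\<^esub> y" "y \<sqsubseteq>\<^bsub>?L\<^esub> x" "x \<in> carrier ?L" "y \<in> carrier ?L" for x y
      using that by (simp add: eq le eqI subset_antisym)
    show "x \<sqsubseteq>\<^bsub>?L\<^esub> z"
      if "x \<sqsubseteq>\<^bsub>?L\<^esub> y" "y \<sqsubseteq>\<^bsub>?L\<^esub> z" "x \<in> carrier ?L" "y \<in> carrier ?L" "z \<in> carrier ?L" for x y z
      using that by (meson le subset_trans)
    show "x \<sqsubseteq>\<^bsub>?L\<^esub> z \<longleftrightarrow> y \<sqsubseteq>\<^bsub>?L\<^esub> w" if "x .=\<^bsub>?L\<^esub> y" "z .=\<^bsub>?L\<^esub> w" for x y z w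
      using that by (simp add: eq)
  qed (simp_all add: eq le)
  have sup: "\<exists>z\<in>carrier ?L. rep z = rep x \<union> rep y"
    if "x \<in> carrier ?L" "y \<in> carrier ?L" for x y
  proof -
    have "biunique (rep x \<union> rep y)"
      using that unfolding carrier by (intro biuniqueI) auto
    then show ?thesis using rep_union[of x y] that by (auto simp: carrier)
  qed
  have inf: "x \<otimes> y \<in> carrier ?L \<and> rep (x \<otimes> y) = rep x \<inter> rep y"
    if "x \<in> carrier ?L" "y \<in> carrier ?L" for x y
    using that unfolding carrier by (auto simp: rep_mult)
  have least: "least ?L z (Upper ?L {x, y})"
    if "x \<in> carrier ?L" "y \<in> carrier ?L" "z \<in> carrier ?L" "rep z = rep x \<union> rep y" for x y z
  proof -
    have "Upper ?L {x, y} = {u \<in> carrier ?L. rep x \<subseteq> rep u \<and> rep y \<subseteq> rep u}"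
      using that by (auto simp: Upper_def le all_conj_distrib)
    then show ?thesis using that by (auto simp: least_def le)
  qed
  have greatest: "greatest ?L (x \<otimes> y) (Lower ?L {x, y})"
    if "x \<in> carrier ?L" "y \<in> carrier ?L" for x y
  proof -
    have "Lower ?L {x, y} = {u \<in> carrier ?L. rep u \<subseteq> rep x \<and> rep u \<subseteq> rep y}"
      using that by (auto simp: Lower_def le all_conj_distrib)
    then show ?thesis using inf[OF that] that by (auto simp: greatest_def le)
  qed
  have zero: "zero \<in> carrier ?L" by (simp add: carrier zero_closed rep_zero)
  have one: "\<one> \<in> carrier ?L" by (simp add: carrier rep_one_subset_Id)
  have rep_le_one: "rep x \<subseteq> rep \<one>" if "x \<in> carrier ?L" for x
  proof -
    have "rep x = rep x O rep \<one>" using that rep_mult[of x \<one>] by (simp add: carrier)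
    then show ?thesis using that by (auto simp: carrier)
  qed
  interpret bounded_lattice ?L
  proof
    show "\<exists>s. least ?L s (Upper ?L {x, y})" if "x \<in> carrier ?L" "y \<in> carrier ?L" for x y
      using sup least that by blast
    show "\<exists>s. greatest ?L s (Lower ?L {x, y})" if "x \<in> carrier ?L" "y \<in> carrier ?L" for x y
      using greatest that by blast
    show "\<exists>x. least ?L x (carrier ?L)"
      using zero by (intro exI[of _ zero]) (auto simp: least_def le rep_zero)
    show "\<exists>x. greatest ?L x (carrier ?L)"
      using one rep_le_one by (intro exI[of _ \<one>]) (auto simp: greatest_def le)
  qed
  have bot: "\<bottom>\<^bsub>?L\<^esub> = zero"
    using zero by (intro bottom_eq[symmetric]) (auto simp: le rep_zero)
  have top: "\<top>\<^bsub>?L\<^esub> = \<one>"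
    using one rep_le_one by (intro top_eq[symmetric]) (auto simp: le)
  have rep_join: "rep (x \<squnion>\<^bsub>?L\<^esub> y) = rep x \<union> rep y"
    if xy: "x \<in> carrier ?L" "y \<in> carrier ?L" for x y
  proof -
    obtain z where z: "z \<in> carrier ?L" "rep z = rep x \<union> rep y" using sup[OF xy] by blast
    have "x \<squnion>\<^bsub>?L\<^esub> y = z"
      by (rule joinI[OF _ xy]) (rule least_unique[OF _ least[OF xy z]])
    then show ?thesis using z by simp
  qed
  have meet: "x \<sqinter>\<^bsub>?L\<^esub> y = x \<otimes> y"
    if "x \<in> carrier ?L" "y \<in> carrier ?L" for x y
    by (rule meetI[OF _ that]) (rule greatest_unique[OF _ greatest[OF that]])
  show ?thesis
  proof
    fix x y z assume "x \<in> carrier ?L" "y \<in> carrier ?L" "z \<in> carrier ?L"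
    then show "x \<sqinter>\<^bsub>?L\<^esub> (y \<squnion>\<^bsub>?L\<^esub> z) = (x \<sqinter>\<^bsub>?L\<^esub> y) \<squnion>\<^bsub>?L\<^esub> (x \<sqinter>\<^bsub>?L\<^esub> z)"
      by (intro eqI) (auto simp: meet rep_join inf)
  next
    fix x assume x: "x \<in> carrier ?L"
    then obtain y where y: "y \<in> carrier T" "rep x \<inter> rep y = {}" "rep x \<union> rep y = rep \<one>"
      using rep_complement[of x] unfolding carrier by blast
    then have y': "y \<in> carrier ?L" using rep_one_subset_Id by (auto simp: carrier)
    have "x \<otimes> y = zero" "x \<squnion>\<^bsub>?L\<^esub> y = \<one>"
      using x y y' by (auto intro!: eqI simp: inf zero one rep_zero rep_join)
    then show "\<exists>y\<in>carrier ?L. x \<sqinter>\<^bsub>?L\<^esub> y = \<bottom>\<^bsub>?L\<^esub> \<and> x \<squnion>\<^bsub>?L\<^esub> y = \<top>\<^bsub>?L\<^esub>"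
      using x y' by (intro bexI[of _ y]) (simp_all add: meet bot top)
  qed
qed

lemma zero_least_projection: "least (natural_order_on T (inv_star T) projections) zero projections"
proof -
  have "zero \<in> projections" by (simp add: projections_rep zero_closed rep_zero)
  moreover have "zero = x \<otimes> inv_star T zero" if "x \<in> projections" for x
    using that natural_order_rep[of zero x] by (simp add: projections_rep zero_closed rep_zero)
  ultimately show ?thesis
    by (simp add: least_def natural_order_on_def natural_order_def)
qed

lemma mult_zero:
  assumes "s \<in> carrier T"
  shows "zero \<otimes> s = zero" "s \<otimes> zero = zero"
  using assms zero_closed by (auto intro!: rep_eqD simp: rep_mult rep_zero)

lemma compatible_join:
  assumes "a \<in> carrier T" "b \<in> carrier T" "compatible a b"
  shows "\<exists>c. is_join T (inv_star T) {a, b} c"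
proof -
  obtain z where "z \<in> carrier T" "rep z = rep a \<union> rep b"
    using rep_union[OF assms(1,2)] compatible_biunique_union[OF assms] by blast
  then have "is_join T (inv_star T) {a, b} z" using assms by (intro is_join_rep) auto
  then show ?thesis by blast
qed

lemma mult_join:
  assumes "a \<in> carrier T" "b \<in> carrier T" "s \<in> carrier T" "compatible a b"
    and "is_join T (inv_star T) {a, b} c"
  shows "is_join T (inv_star T) {s \<otimes> a, s \<otimes> b} (s \<otimes> c)"
    and "is_join T (inv_star T) {a \<otimes> s, b \<otimes> s} (c \<otimes> s)"
  using assms(1-3) is_join_pair_rep[OF assms(1,2,4,5)]
  by (auto intro!: is_join_rep simp: rep_mult)

sublocale boolean_inverse_monoid T zero
  by intro_locales (rule boolean_restriction_monoid_axioms.intro; fact zero_closed mult_zero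
      compatible_join mult_join boolean_lattice_projections zero_least_projection)

end

section \<open>Projections of restriction monoids\<close>

context restriction_monoid
begin

declare star_closed [simp] pls_closed [simp]

lemma star_projection [simp]: "s \<in> carrier M \<Longrightarrow> star s \<in> projections"
  and pls_projection [simp]: "s \<in> carrier M \<Longrightarrow> pls s \<in> projections"
  unfolding projections_def by auto

lemma projection_closed [simp]: "e \<in> projections \<Longrightarrow> e \<in> carrier M"
  unfolding projections_def by auto

lemma star_of_projection [simp]: "e \<in> projections \<Longrightarrow> star e = e"
  and pls_of_projection [simp]: "e \<in> projections \<Longrightarrow> pls e = e"
  unfolding projections_def using A1 by auto

lemma one_projection [simp]: "\<one> \<in> projections"
  using A4(1)[of \<one>] star_projection[of \<one>] by simp

lemma projection_mult [simp]: "\<lbrakk>e \<in> projections; f \<in> projections\<rbrakk> \<Longrightarrow> e \<otimes> f \<in> projections"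
  using A2(1)[of e f] star_projection[of "e \<otimes> f"] by simp

lemma projection_commute: "\<lbrakk>e \<in> projections; f \<in> projections\<rbrakk> \<Longrightarrow> e \<otimes> f = f \<otimes> e"
  using A3(1)[of e f] by simp

lemma projection_idem [simp]: "e \<in> projections \<Longrightarrow> e \<otimes> e = e"
  using A4(1)[of e] by simp

lemma star_mult_projection:
  "\<lbrakk>s \<in> carrier M; e \<in> projections\<rbrakk> \<Longrightarrow> star (s \<otimes> e) = star s \<otimes> e"
  using A5(1)[of s e] by simp

lemma pls_projection_mult:
  "\<lbrakk>s \<in> carrier M; e \<in> projections\<rbrakk> \<Longrightarrow> pls (e \<otimes> s) = e \<otimes> pls s"
  using A5(2)[of e s] by simp

lemma projection_slide_right:
  "\<lbrakk>s \<in> carrier M; e \<in> projections\<rbrakk> \<Longrightarrow> e \<otimes> s = s \<otimes> star (e \<otimes> s)"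
  using A6(1)[of s e] by simp

lemma projection_slide_left:
  "\<lbrakk>s \<in> carrier M; e \<in> projections\<rbrakk> \<Longrightarrow> s \<otimes> e = pls (s \<otimes> e) \<otimes> s"
  using A6(2)[of s e] by simp

lemma pls_mult_absorb:
  assumes "s \<in> carrier M" "t \<in> carrier M"
  shows "pls s \<otimes> pls (s \<otimes> t) = pls (s \<otimes> t)"
  using pls_projection_mult[of "s \<otimes> t" "pls s"] assms A4(2)[of s] by (simp flip: m_assoc)

lemma projections_subset_idempotents: "projections \<subseteq> idempotents M"
  unfolding idempotents_def by auto

lemma is_join_pair_iff:
  assumes "a \<in> carrier M" "b \<in> carrier M"
  shows "is_join M star {a, b} c \<longleftrightarrow> c \<in> carrier M \<and> a = c \<otimes> star a \<and> b = c \<otimes> star b \<and>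
    (\<forall>d\<in>carrier M. a = d \<otimes> star a \<longrightarrow> b = d \<otimes> star b \<longrightarrow> c = d \<otimes> star c)"
  using assms unfolding is_join_def least_def Upper_def natural_order_def by auto

text \<open>Antisymmetry of the natural order: the mutual bounds make each star equal to the product
  of both.\<close>

lemma is_join_unique:
  assumes "is_join M star A c" "is_join M star A d"
  shows "c = d"
proof -
  have cd: "c \<in> carrier M" "d \<in> carrier M" "c = d \<otimes> star c" "d = c \<otimes> star d"
    using assms unfolding is_join_def least_def Upper_def natural_order_def by auto
  have "star c = star d \<otimes> star c" "star d = star c \<otimes> star d"
    using star_mult_projection[of d "star c"] star_mult_projection[of c "star d"] cd by auto
  then have "star c = star d" using A3(1)[of c d] cd by simp
  then show ?thesis using cd A4(1)[of d] by simp
qed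

text \<open>\<open>is_join\<close> refers to the whole monoid. As \<open>\<one>\<close> is an upper
  bound of \<open>e\<close> and \<open>f\<close>, the join lies below \<open>\<one>\<close> and is
  itself a projection, so it is also their join among projections.\<close>

lemma is_join_projection:
  assumes e: "e \<in> projections" and f: "f \<in> projections" and g: "is_join M star {e, f} g"
  shows "g \<in> projections" "g \<otimes> e = e" "g \<otimes> f = f"
    and "\<And>h. \<lbrakk>h \<in> projections; h \<otimes> e = e; h \<otimes> f = f\<rbrakk> \<Longrightarrow> h \<otimes> g = g"
proof -
  note J = g[unfolded is_join_pair_iff[OF projection_closed[OF e] projection_closed[OF f]]]
  have "g = \<one> \<otimes> star g" using J e f by simp
  then have "g = star g" using J by simp
  then show "g \<in> projections" using J star_projection by metis
  then show "g \<otimes> e = e" "g \<otimes> f = f" "\<And>h. \<lbrakk>h \<in> projections; h \<otimes> e = e; h \<otimes> f = f\<rbrakk> \<Longrightarrow> h \<otimes> g = g"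
    using J e f by simp_all
qed

lemma projections_compatible: "\<lbrakk>e \<in> projections; f \<in> projections\<rbrakk> \<Longrightarrow> compatible e f"
  unfolding compatible_def using projection_commute by simp

end

text \<open>Cancelling \<open>e\<close> in \<open>\<one> \<otimes> e = e \<otimes> e\<close> by (A7)
  gives \<open>pls e = e \<otimes> pls e\<close>, and (A6) with (A5) reduces the right side to
  \<open>e\<close>.\<close>

lemma (in ample_monoid) idempotents_eq_projections: "idempotents M = projections"
proof
  show "idempotents M \<subseteq> projections"
  proof
    fix e assume "e \<in> idempotents M"
    then have e: "e \<in> carrier M" "e \<otimes> e = e" unfolding idempotents_def by auto
    have "pls e = e \<otimes> pls e" using A7(1)[of \<one> e e] e by simp
    also have "\<dots> = pls (e \<otimes> pls e) \<otimes> e" using projection_slide_left[of e "pls e"] e by simp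
    also have "\<dots> = e" using A5(2)[of e e] A4(2)[of e] e by simp
    finally show "e \<in> projections" using pls_projection e by metis
  qed
qed (rule projections_subset_idempotents)

section \<open>Prime filters of projections\<close>

context boolean_restriction_monoid
begin

lemma zero_projection [simp]: "zero \<in> projections"
  using zero_bottom unfolding least_def by simp

lemma projection_join_ex:
  "\<lbrakk>e \<in> projections; f \<in> projections\<rbrakk> \<Longrightarrow> \<exists>g. is_join M star {e, f} g"
  using compatible_join_exists projections_compatible by simp

lemma projection_join_mult:
  assumes "e \<in> projections" "f \<in> projections" "is_join M star {e, f} g" "s \<in> carrier M"
  shows "is_join M star {s \<otimes> e, s \<otimes> f} (s \<otimes> g)" "is_join M star {e \<otimes> s, f \<otimes> s} (g \<otimes> s)"
  using mult_join_distrib[of e f s g] projections_compatible assms by simp_all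

text \<open>Prime filters expressed through products and \<open>is_join\<close>, so that transport
  along elements can be computed with monoid identities. Upward closure is hidden in the equivalence
  for products.\<close>

definition prime :: "'a set \<Rightarrow> bool" where
  "prime F \<longleftrightarrow> F \<subseteq> projections \<and> \<one> \<in> F \<and> zero \<notin> F \<and>
     (\<forall>e\<in>projections. \<forall>f\<in>projections. e \<otimes> f \<in> F \<longleftrightarrow> e \<in> F \<and> f \<in> F) \<and>
     (\<forall>e\<in>projections. \<forall>f\<in>projections. \<forall>g\<in>F. is_join M star {e, f} g \<longrightarrow> e \<in> F \<or> f \<in> F)"

lemma primeD:
  assumes "prime F"
  shows "e \<in> F \<Longrightarrow> e \<in> projections" "\<one> \<in> F" "zero \<notin> F"
    and "\<lbrakk>e \<in> projections; f \<in> projections\<rbrakk> \<Longrightarrow> e \<otimes> f \<in> F \<longleftrightarrow> e \<in> F \<and> f \<in> F"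
    and "\<lbrakk>e \<in> projections; f \<in> projections; g \<in> F; is_join M star {e, f} g\<rbrakk> \<Longrightarrow> e \<in> F \<or> f \<in> F"
  using assms unfolding prime_def by blast+

lemma prime_upward: "\<lbrakk>prime F; e \<in> F; f \<in> projections; f \<otimes> e = e\<rbrakk> \<Longrightarrow> f \<in> F"
  using primeD(1,4) by metis

lemma prime_join_iff:
  assumes "prime F" "e \<in> projections" "f \<in> projections" "is_join M star {e, f} g"
  shows "g \<in> F \<longleftrightarrow> e \<in> F \<or> f \<in> F"
  using assms primeD(5) prime_upward is_join_projection[OF assms(2-4)] by metis

text \<open>Makes the order-theoretic hypothesis of the theorem applicable to every
  \<open>prime\<close> set.\<close>

lemma prime_filter_if_prime:
  assumes F: "prime F"
  shows "prime_filter (natural_order_on M star projections) F" (is "prime_filter ?L F")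
proof -
  have carrier: "carrier ?L = projections" by (simp add: natural_order_on_def)
  have le: "x \<sqsubseteq>\<^bsub>?L\<^esub> y \<longleftrightarrow> y \<otimes> x = x" if "x \<in> projections" for x y
    using that by (auto simp: natural_order_on_def natural_order_def)
  interpret L: boolean_lattice ?L by (rule projections_boolean)
  have bot: "\<bottom>\<^bsub>?L\<^esub> = zero"
    using zero_mult by (intro L.bottom_eq[symmetric]) (auto simp: carrier le)
  have meet: "x \<sqinter>\<^bsub>?L\<^esub> y = x \<otimes> y" if xy: "x \<in> projections" "y \<in> projections" for x y
  proof (rule L.le_antisym)
    show "x \<sqinter>\<^bsub>?L\<^esub> y \<sqsubseteq>\<^bsub>?L\<^esub> x \<otimes> y"
      using L.meet_left[of x y] L.meet_right[of x y] L.meet_closed[of x y] xy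
      by (simp add: carrier le m_assoc)
    show "x \<otimes> y \<sqsubseteq>\<^bsub>?L\<^esub> x \<sqinter>\<^bsub>?L\<^esub> y"
      using xy projection_commute[of x y]
      by (intro L.meet_le) (simp_all add: carrier le flip: m_assoc, simp add: m_assoc)
  qed (use xy L.meet_closed[of x y] in \<open>simp_all add: carrier\<close>)
  have join: "x \<squnion>\<^bsub>?L\<^esub> y = g" if xy: "x \<in> projections" "y \<in> projections" and g: "is_join M star {x, y} g" for x y g
  proof (rule L.le_antisym)
    note J = is_join_projection[OF xy g]
    show "x \<squnion>\<^bsub>?L\<^esub> y \<sqsubseteq>\<^bsub>?L\<^esub> g"
      using xy J by (intro L.join_le) (simp_all add: carrier le)
    show "g \<sqsubseteq>\<^bsub>?L\<^esub> x \<squnion>\<^bsub>?L\<^esub> y"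
      using L.join_left[of x y] L.join_right[of x y] L.join_closed[of x y] xy J
      by (simp add: carrier le)
  qed (use xy is_join_projection(1)[OF xy g] L.join_closed[of x y] in \<open>simp_all add: carrier\<close>)
  have sub: "F \<subseteq> projections" and one: "\<one> \<in> F" using primeD[OF F] by auto
  have "x \<in> F \<or> y \<in> F"
    if xy: "x \<in> projections" "y \<in> projections" "x \<squnion>\<^bsub>?L\<^esub> y \<in> F" for x y
  proof -
    obtain g where g: "is_join M star {x, y} g" using projection_join_ex xy by blast
    then show ?thesis using join xy primeD(5)[OF F] by metis
  qed
  moreover have "y \<in> F" if "x \<in> F" "y \<in> projections" "x \<sqsubseteq>\<^bsub>?L\<^esub> y" for x y
    using that prime_upward[OF F] le sub by (metis subsetD)
  moreover have "x \<sqinter>\<^bsub>?L\<^esub> y \<in> F" if "x \<in> F" "y \<in> F" for x y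
    using that primeD(4)[OF F] meet sub by (metis subsetD)
  ultimately show ?thesis
    unfolding prime_filter_def order_filter_def carrier bot
    using sub one primeD(3)[OF F] by blast
qed

lemma projection_complement_ex:
  assumes "e \<in> projections"
  shows "\<exists>f\<in>projections. e \<otimes> f = zero \<and> is_join M star {e, f} \<one>"
proof -
  let ?L = "natural_order_on M star projections"
  have carrier: "carrier ?L = projections" by (simp add: natural_order_on_def)
  have le: "x \<sqsubseteq>\<^bsub>?L\<^esub> y \<longleftrightarrow> y \<otimes> x = x" if "x \<in> projections" for x y
    using that by (auto simp: natural_order_on_def natural_order_def)
  interpret L: boolean_lattice ?L by (rule projections_boolean)
  have bot: "\<bottom>\<^bsub>?L\<^esub> = zero"
    using zero_mult by (intro L.bottom_eq[symmetric]) (auto simp: carrier le)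
  have top: "\<top>\<^bsub>?L\<^esub> = \<one>"
    by (intro L.top_eq[symmetric]) (auto simp: carrier le)
  obtain f where f: "f \<in> projections" "e \<sqinter>\<^bsub>?L\<^esub> f = zero" "e \<squnion>\<^bsub>?L\<^esub> f = \<one>"
    using L.complement_exists[of e] assms unfolding carrier bot top by blast
  obtain g where g: "is_join M star {e, f} g" using projection_join_ex assms f by blast
  note J = is_join_projection[OF assms f(1) g]
  have "e \<otimes> f \<sqsubseteq>\<^bsub>?L\<^esub> e \<sqinter>\<^bsub>?L\<^esub> f"
    using assms f(1) projection_commute[of e f]
    by (intro L.meet_le) (simp_all add: carrier le flip: m_assoc, simp add: m_assoc)
  then have "e \<otimes> f = zero" using f assms zero_mult by (simp add: le)
  moreover have "e \<squnion>\<^bsub>?L\<^esub> f \<sqsubseteq>\<^bsub>?L\<^esub> g"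
    using assms f(1) J by (intro L.join_le) (simp_all add: carrier le)
  then have "g = \<one>" using f(3) J(1) by (simp add: le)
  ultimately show ?thesis using f(1) g by blast
qed

section \<open>The prime filter theorem for projections\<close>

definition projection_ideal :: "'a set \<Rightarrow> bool" where
  "projection_ideal I \<longleftrightarrow> I \<subseteq> projections \<and> zero \<in> I \<and>
     (\<forall>e\<in>I. \<forall>f\<in>projections. e \<otimes> f \<in> I) \<and>
     (\<forall>e\<in>I. \<forall>f\<in>I. \<forall>g. is_join M star {e, f} g \<longrightarrow> g \<in> I)"

lemma projection_idealD:
  assumes "projection_ideal I"
  shows "I \<subseteq> projections" "zero \<in> I" "\<lbrakk>e \<in> I; f \<in> projections\<rbrakk> \<Longrightarrow> e \<otimes> f \<in> I"
    and "\<lbrakk>e \<in> I; f \<in> I; is_join M star {e, f} g\<rbrakk> \<Longrightarrow> g \<in> I"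
  using assms unfolding projection_ideal_def by blast+

definition projection_filter :: "'a set \<Rightarrow> bool" where
  "projection_filter F \<longleftrightarrow> F \<subseteq> projections \<and> \<one> \<in> F \<and>
     (\<forall>e\<in>projections. \<forall>f\<in>projections. e \<otimes> f \<in> F \<longleftrightarrow> e \<in> F \<and> f \<in> F)"

text \<open>\<open>G\<close> is the filter generated by \<open>F\<close> and \<open>x\<close>:
  everything above some \<open>f \<otimes> x\<close> with \<open>f \<in> F\<close>.\<close>

lemma projection_filter_extend:
  assumes F: "projection_filter F" and x: "x \<in> projections"
    and G: "G = {e \<in> projections. \<exists>f\<in>F. e \<otimes> (f \<otimes> x) = f \<otimes> x}"
  shows "projection_filter G" "F \<subseteq> G" "x \<in> G"
proof -
  have sub: "F \<subseteq> projections" and one: "\<one> \<in> F"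
    and mult: "\<And>e f. \<lbrakk>e \<in> projections; f \<in> projections\<rbrakk> \<Longrightarrow> e \<otimes> f \<in> F \<longleftrightarrow> e \<in> F \<and> f \<in> F"
    using F unfolding projection_filter_def by auto
  show "F \<subseteq> G"
  proof
    fix e assume e: "e \<in> F"
    then have "e \<otimes> (e \<otimes> x) = e \<otimes> x" using sub x by (simp add: subset_iff flip: m_assoc)
    then show "e \<in> G" using e sub unfolding G by blast
  qed
  show "x \<in> G" using one x unfolding G by (auto intro!: bexI[of _ \<one>])
  have "e \<otimes> f \<in> G \<longleftrightarrow> e \<in> G \<and> f \<in> G" if ef: "e \<in> projections" "f \<in> projections" for e f
  proof
    assume "e \<otimes> f \<in> G"
    then obtain h where h: "h \<in> F" "e \<otimes> f \<otimes> (h \<otimes> x) = h \<otimes> x" unfolding G by blast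
    then have hp: "h \<in> projections" using sub by blast
    have "e \<otimes> (h \<otimes> x) = h \<otimes> x"
    proof -
      have "e \<otimes> (h \<otimes> x) = e \<otimes> (e \<otimes> f \<otimes> (h \<otimes> x))" using h by simp
      also have "\<dots> = e \<otimes> f \<otimes> (h \<otimes> x)" using ef hp x by (simp flip: m_assoc)
      finally show ?thesis using h by simp
    qed
    moreover have "f \<otimes> (h \<otimes> x) = h \<otimes> x"
    proof -
      have "f \<otimes> (h \<otimes> x) = f \<otimes> (f \<otimes> e \<otimes> (h \<otimes> x))" using h projection_commute[OF ef] by simp
      also have "\<dots> = f \<otimes> e \<otimes> (h \<otimes> x)" using ef hp x by (simp flip: m_assoc)
      finally show ?thesis using h projection_commute[OF ef] by simp
    qed
    ultimately show "e \<in> G \<and> f \<in> G" using ef h(1) unfolding G by blast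
  next
    assume "e \<in> G \<and> f \<in> G"
    then obtain h k where hk: "h \<in> F" "k \<in> F" "e \<otimes> (h \<otimes> x) = h \<otimes> x" "f \<otimes> (k \<otimes> x) = k \<otimes> x" unfolding G by blast
    then have p: "h \<in> projections" "k \<in> projections" using sub by auto
    have hkF: "h \<otimes> k \<in> F" using mult[OF p] hk by blast
    have c: "h \<otimes> k = k \<otimes> h" using projection_commute p by blast
    have 1: "f \<otimes> (h \<otimes> k \<otimes> x) = h \<otimes> k \<otimes> x"
    proof -
      have "f \<otimes> (h \<otimes> k \<otimes> x) = h \<otimes> (f \<otimes> (k \<otimes> x))"
        using projection_commute[of f h] ef p x by (simp flip: m_assoc)
      then show ?thesis using hk ef p x by (simp add: m_assoc)
    qed
    have 2: "e \<otimes> (h \<otimes> k \<otimes> x) = h \<otimes> k \<otimes> x"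
    proof -
      have "e \<otimes> (h \<otimes> k \<otimes> x) = k \<otimes> (e \<otimes> (h \<otimes> x))"
        using projection_commute[of e k] ef p x c by (simp flip: m_assoc)
      then show ?thesis using hk ef p x c by (simp add: m_assoc)
    qed
    have "e \<otimes> f \<otimes> (h \<otimes> k \<otimes> x) = h \<otimes> k \<otimes> x"
      using 1 2 ef p x by (simp add: m_assoc)
    then show "e \<otimes> f \<in> G" using hkF ef unfolding G by auto
  qed
  then show "projection_filter G"
    using \<open>F \<subseteq> G\<close> one unfolding projection_filter_def G by blast
qed

text \<open>For \<open>x \<notin> F\<close> maximality makes the filter generated by
  \<open>F\<close> and \<open>x\<close> meet \<open>I\<close>, so some \<open>f \<otimes> x\<close>
  lies in \<open>I\<close>. If a join in \<open>F\<close> had both parts outside \<open>F\<close>,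
  multiplying it by two such \<open>f\<close> would give an element of both \<open>F\<close> and
  \<open>I\<close>.\<close>

lemma prime_if_maximal:
  assumes F: "projection_filter F" and I: "projection_ideal I" and disj: "F \<inter> I = {}"
    and max: "\<And>G. \<lbrakk>projection_filter G; F \<subseteq> G; G \<inter> I = {}\<rbrakk> \<Longrightarrow> G = F"
  shows "prime F"
proof -
  have sub: "F \<subseteq> projections" and one: "\<one> \<in> F"
    and mult: "\<And>e f. \<lbrakk>e \<in> projections; f \<in> projections\<rbrakk> \<Longrightarrow> e \<otimes> f \<in> F \<longleftrightarrow> e \<in> F \<and> f \<in> F"
    using F unfolding projection_filter_def by auto
  note I0 = projection_idealD(2)[OF I] and Im = projection_idealD(3)[OF I]
    and Ij = projection_idealD(4)[OF I]
  have meets: "\<exists>f\<in>F. f \<otimes> x \<in> I" if x: "x \<in> projections" "x \<notin> F" for x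
  proof -
    let ?G = "{e \<in> projections. \<exists>f\<in>F. e \<otimes> (f \<otimes> x) = f \<otimes> x}"
    have "?G \<inter> I \<noteq> {}"
      using projection_filter_extend[OF F x(1) refl] max[of ?G] x(2) by blast
    then obtain e f where ef: "e \<in> I" "f \<in> F" "e \<otimes> (f \<otimes> x) = f \<otimes> x" by blast
    then show ?thesis using Im[of e "f \<otimes> x"] sub x(1) by (metis projection_mult subsetD)
  qed
  have join: "x \<in> F \<or> y \<in> F"
    if xy: "x \<in> projections" "y \<in> projections" and g: "g \<in> F" "is_join M star {x, y} g" for x y g
  proof (rule ccontr)
    assume "\<not> ?thesis"
    then obtain h k where hk: "h \<in> F" "h \<otimes> x \<in> I" "k \<in> F" "k \<otimes> y \<in> I"
      using meets xy by blast
    then have p: "h \<in> projections" "k \<in> projections" using sub by auto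
    have "k \<otimes> h \<otimes> x = h \<otimes> x \<otimes> k"
      using p xy projection_commute[of k "h \<otimes> x"] by (simp add: m_assoc)
    then have "k \<otimes> h \<otimes> x \<in> I" using Im[OF hk(2) p(2)] by simp
    moreover have "k \<otimes> h \<otimes> y = k \<otimes> y \<otimes> h"
      using p xy projection_commute[of h y] by (simp add: m_assoc)
    then have "k \<otimes> h \<otimes> y \<in> I" using Im[OF hk(4) p(1)] by simp
    ultimately have "k \<otimes> h \<otimes> g \<in> I"
      by (rule Ij) (rule projection_join_mult(1)[OF xy g(2)], use p in simp)
    moreover have "k \<otimes> h \<otimes> g \<in> F" using mult hk g p sub by (metis projection_mult subsetD)
    ultimately show False using disj by blast
  qed
  have zero: "zero \<notin> F" using disj I0 by blast
  show ?thesis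
    unfolding prime_def
    by (intro conjI ballI impI) (assumption | rule sub one zero mult join)+
qed

theorem prime_filter_exists:
  assumes I: "projection_ideal I" and e: "e \<in> projections" "e \<notin> I"
  shows "\<exists>F. prime F \<and> e \<in> F \<and> F \<inter> I = {}"
proof -
  define A where "A = {F. projection_filter F \<and> e \<in> F \<and> F \<inter> I = {}}"
  have triv: "projection_filter {\<one>}"
  proof -
    have "e \<otimes> f \<in> {\<one>} \<longleftrightarrow> e \<in> {\<one>} \<and> f \<in> {\<one>}" if "e \<in> projections" "f \<in> projections" for e f
    proof -
      have "e \<otimes> f \<otimes> f = e \<otimes> f" "e \<otimes> (e \<otimes> f) = e \<otimes> f"
        using that by (simp add: m_assoc, simp flip: m_assoc)
      then show ?thesis using that by auto
    qed
    then show ?thesis unfolding projection_filter_def using one_projection by blast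
  qed
  \<comment> \<open>The principal filter of \<open>e\<close>, written as an extension of the trivial
    filter; it shows that Zorn's lemma is applied to a nonempty family.\<close>
  let ?G = "{x \<in> projections. \<exists>f\<in>{\<one>}. x \<otimes> (f \<otimes> e) = f \<otimes> e}"
  have "x \<notin> I" if x: "x \<in> ?G" for x
  proof
    assume "x \<in> I"
    moreover have "x \<otimes> e = e" using x e by simp
    ultimately show False using projection_idealD(3)[OF I, of x e] e by simp
  qed
  then have "?G \<inter> I = {}" by blast
  then have "?G \<in> A" using projection_filter_extend[OF triv e(1) refl] unfolding A_def by blast
  moreover have "\<Union>C \<in> A" if C: "C \<noteq> {}" "subset.chain A C" for C
  proof -
    have CA: "C \<subseteq> A" and total: "\<And>F G. \<lbrakk>F \<in> C; G \<in> C\<rbrakk> \<Longrightarrow> F \<subseteq> G \<or> G \<subseteq> F"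
      using C(2) unfolding subset.chain_def by auto
    have "x \<otimes> y \<in> \<Union>C \<longleftrightarrow> x \<in> \<Union>C \<and> y \<in> \<Union>C" if xy: "x \<in> projections" "y \<in> projections" for x y
    proof
      assume "x \<in> \<Union>C \<and> y \<in> \<Union>C"
      then obtain F G where FG: "F \<in> C" "x \<in> F" "G \<in> C" "y \<in> G" by blast
      then obtain H where "H \<in> C" "x \<in> H" "y \<in> H" using total[of F G] by blast
      then show "x \<otimes> y \<in> \<Union>C" using CA xy unfolding A_def projection_filter_def by blast
    next
      assume "x \<otimes> y \<in> \<Union>C"
      then show "x \<in> \<Union>C \<and> y \<in> \<Union>C" using CA xy unfolding A_def projection_filter_def by blast
    qed
    moreover have "\<Union>C \<subseteq> projections" "\<one> \<in> \<Union>C" "e \<in> \<Union>C" "\<Union>C \<inter> I = {}"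
      using CA C(1) unfolding A_def projection_filter_def by auto
    ultimately show ?thesis unfolding A_def projection_filter_def by blast
  qed
  ultimately obtain F where F: "F \<in> A" "\<forall>X\<in>A. F \<subseteq> X \<longrightarrow> X = F"
    using subset_Zorn_nonempty[of A] by blast
  then have "prime F"
    using I unfolding A_def by (intro prime_if_maximal[of F I]) auto
  then show ?thesis using F(1) unfolding A_def by blast
qed

end

section \<open>Transporting prime filters\<close>

context boolean_restriction_monoid
begin

text \<open>An element \<open>p\<close> is viewed as a partial map of prime filters:
  \<open>pull p\<close> and \<open>push p\<close> turn out to be mutually inverse bijections between
  the prime filters containing \<open>pls p\<close> and those containing
  \<open>star p\<close>.\<close>

definition pull :: "'a \<Rightarrow> 'a set \<Rightarrow> 'a set" where
  "pull p K = {e \<in> projections. pls (p \<otimes> e) \<in> K}"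

definition push :: "'a \<Rightarrow> 'a set \<Rightarrow> 'a set" where
  "push p H = {e \<in> projections. star (e \<otimes> p) \<in> H}"

lemma pull_one: "prime K \<Longrightarrow> pull \<one> K = K"
  unfolding pull_def using primeD(1) by auto

lemma push_one: "prime H \<Longrightarrow> push \<one> H = H"
  unfolding push_def using primeD(1) by auto

lemma pull_mult:
  assumes "p \<in> carrier M" "q \<in> carrier M"
  shows "pull (p \<otimes> q) K = pull q (pull p K)"
proof -
  have "pls (p \<otimes> q \<otimes> e) = pls (p \<otimes> pls (q \<otimes> e))" if "e \<in> projections" for e
    using A5(2)[of p "q \<otimes> e"] assms that by (simp add: m_assoc)
  then show ?thesis unfolding pull_def using assms by auto
qed

lemma pull_projection:
  assumes "prime H" "k \<in> H"
  shows "pull k H = H"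
  using assms primeD(1)[OF assms(1)] primeD(4)[OF assms(1)] unfolding pull_def by auto

text \<open>Going back along \<open>c \<otimes> q\<close> and forward along \<open>c\<close> leaves
  the step back along \<open>q\<close>. Sliding \<open>e\<close> through both factors gives
  \<open>star (c \<otimes> q) \<otimes> star (e \<otimes> q)\<close>, whose first factor lies in
  \<open>H\<close>.\<close>

lemma pull_push_mult:
  assumes c: "c \<in> carrier M" and q: "q \<in> carrier M" and H: "prime H" and cq: "star (c \<otimes> q) \<in> H"
  shows "pull c (push (c \<otimes> q) H) = push q H"
proof -
  have "star (pls (c \<otimes> e) \<otimes> (c \<otimes> q)) \<in> H \<longleftrightarrow> star (e \<otimes> q) \<in> H" if e: "e \<in> projections" for e
  proof -
    have "pls (c \<otimes> e) \<otimes> (c \<otimes> q) = c \<otimes> (e \<otimes> q)"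
      using c q e projection_slide_left[of c e] by (simp flip: m_assoc)
    also have "\<dots> = c \<otimes> q \<otimes> star (e \<otimes> q)"
      using c q e projection_slide_right[of q e] by (simp add: m_assoc)
    finally have "star (pls (c \<otimes> e) \<otimes> (c \<otimes> q)) = star (c \<otimes> q) \<otimes> star (e \<otimes> q)"
      using c q e star_mult_projection[of "c \<otimes> q" "star (e \<otimes> q)"] by simp
    then show ?thesis using primeD(4)[OF H] c q e cq by simp
  qed
  then show ?thesis unfolding pull_def push_def using c by auto
qed

lemma pull_push:
  assumes "p \<in> carrier M" "prime H" "star p \<in> H"
  shows "pull p (push p H) = H"
  using pull_push_mult[of p \<one> H] assms push_one by simp

lemma push_pull:
  assumes q: "q \<in> carrier M" and K: "prime K" "pls q \<in> K"
  shows "push q (pull q K) = K"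
proof -
  have "pls (q \<otimes> star (e \<otimes> q)) \<in> K \<longleftrightarrow> e \<in> K" if e: "e \<in> projections" for e
  proof -
    have "pls (q \<otimes> star (e \<otimes> q)) = e \<otimes> pls q"
      using q e projection_slide_right[of q e] pls_projection_mult[of q e] by simp
    then show ?thesis using primeD(4)[OF K(1), of e "pls q"] q e K(2) by simp
  qed
  then show ?thesis unfolding pull_def push_def using q primeD(1)[OF K(1)] by auto
qed

lemma prime_pull:
  assumes p: "p \<in> carrier M" and K: "prime K" and pK: "pls p \<in> K"
  shows "prime (pull p K)"
proof -
  have mult: "pls (p \<otimes> (e \<otimes> f)) \<in> K \<longleftrightarrow> pls (p \<otimes> e) \<in> K \<and> pls (p \<otimes> f) \<in> K"
    if e: "e \<in> projections" and f: "f \<in> projections" for e f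
  proof -
    have "p \<otimes> (e \<otimes> f) = pls (p \<otimes> e) \<otimes> (p \<otimes> f)"
      using p e f projection_slide_left[of p e] by (simp flip: m_assoc)
    then have "pls (p \<otimes> (e \<otimes> f)) = pls (p \<otimes> e) \<otimes> pls (p \<otimes> f)"
      using p e f pls_projection_mult[of "p \<otimes> f" "pls (p \<otimes> e)"] by simp
    then show ?thesis using primeD(4)[OF K] p e f by simp
  qed
  have join: "pls (p \<otimes> e) \<in> K \<or> pls (p \<otimes> f) \<in> K"
    if e: "e \<in> projections" and f: "f \<in> projections" and gK: "pls (p \<otimes> g) \<in> K"
      and g: "is_join M star {e, f} g" for e f g
  proof -
    let ?e = "pls (p \<otimes> e)" and ?f = "pls (p \<otimes> f)"
    note J = is_join_projection[OF e f g]
    \<comment> \<open>\<open>h\<close> joins the transported parts. By distributivity both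
      \<open>h \<otimes> (p \<otimes> g)\<close> and \<open>p \<otimes> g\<close> are joins of
      \<open>p \<otimes> e\<close> and \<open>p \<otimes> f\<close>, so \<open>h\<close> lies above
      \<open>pls (p \<otimes> g)\<close> and primeness of \<open>K\<close> applies to
      \<open>h\<close>.\<close>
    obtain h where h: "is_join M star {?e, ?f} h"
      using projection_join_ex[of ?e ?f] p e f by auto
    have hp: "h \<in> projections" using is_join_projection(1)[OF _ _ h] p e f by simp
    have "?e \<otimes> (p \<otimes> g) = p \<otimes> e" "?f \<otimes> (p \<otimes> g) = p \<otimes> f"
      using projection_slide_left[of "p \<otimes> g" e] projection_slide_left[of "p \<otimes> g" f] p e f J
      by (simp_all add: m_assoc)
    then have "is_join M star {p \<otimes> e, p \<otimes> f} (h \<otimes> (p \<otimes> g))"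
      using projection_join_mult(2)[OF _ _ h, of "p \<otimes> g"] p e f J(1) by simp
    then have "h \<otimes> (p \<otimes> g) = p \<otimes> g"
      using projection_join_mult(1)[OF e f g p] is_join_unique by blast
    then have "h \<otimes> pls (p \<otimes> g) = pls (p \<otimes> g)"
      using pls_projection_mult[of "p \<otimes> g" h] p J(1) hp by simp
    then have "h \<in> K" using prime_upward[OF K gK hp] by simp
    then show ?thesis using primeD(5)[OF K _ _ _ h] p e f by simp
  qed
  show ?thesis
    unfolding prime_def
  proof (intro conjI ballI impI)
    show "pull p K \<subseteq> projections" unfolding pull_def by blast
    show "\<one> \<in> pull p K" unfolding pull_def using p pK by simp
    show "zero \<notin> pull p K" unfolding pull_def using p zero_mult(2) primeD(3)[OF K] by simp
    show "e \<otimes> f \<in> pull p K \<longleftrightarrow> e \<in> pull p K \<and> f \<in> pull p K"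
      if "e \<in> projections" "f \<in> projections" for e f
      using that mult unfolding pull_def by simp
    show "e \<in> pull p K \<or> f \<in> pull p K"
      if "e \<in> projections" "f \<in> projections" "g \<in> pull p K" "is_join M star {e, f} g" for e f g
      using that join[of e f g] unfolding pull_def by simp
  qed
qed

lemma prime_push:
  assumes p: "p \<in> carrier M" and H: "prime H" and pH: "star p \<in> H"
  shows "prime (push p H)"
proof -
  have mult: "star (e \<otimes> f \<otimes> p) \<in> H \<longleftrightarrow> star (e \<otimes> p) \<in> H \<and> star (f \<otimes> p) \<in> H"
    if e: "e \<in> projections" and f: "f \<in> projections" for e f
  proof -
    have "e \<otimes> f \<otimes> p = e \<otimes> p \<otimes> star (f \<otimes> p)"
      using p e f projection_slide_right[of p f] by (simp add: m_assoc)
    then have "star (e \<otimes> f \<otimes> p) = star (e \<otimes> p) \<otimes> star (f \<otimes> p)"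
      using p e f star_mult_projection[of "e \<otimes> p" "star (f \<otimes> p)"] by simp
    then show ?thesis using primeD(4)[OF H] p e f by simp
  qed
  have join: "star (e \<otimes> p) \<in> H \<or> star (f \<otimes> p) \<in> H"
    if e: "e \<in> projections" and f: "f \<in> projections" and gH: "star (g \<otimes> p) \<in> H"
      and g: "is_join M star {e, f} g" for e f g
  proof -
    let ?e = "star (e \<otimes> p)" and ?f = "star (f \<otimes> p)"
    note J = is_join_projection[OF e f g]
    have eg: "e \<otimes> g = e" "f \<otimes> g = f"
      using projection_commute[OF e J(1)] projection_commute[OF f J(1)] J by simp_all
    obtain h where h: "is_join M star {?e, ?f} h"
      using projection_join_ex[of ?e ?f] p e f by auto
    have hp: "h \<in> projections" using is_join_projection(1)[OF _ _ h] p e f by simp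
    have "e \<otimes> (g \<otimes> p) = e \<otimes> p" "f \<otimes> (g \<otimes> p) = f \<otimes> p"
      using eg p e f J(1) by (simp_all flip: m_assoc)
    then have "g \<otimes> p \<otimes> ?e = e \<otimes> p" "g \<otimes> p \<otimes> ?f = f \<otimes> p"
      using projection_slide_right[of "g \<otimes> p" e] projection_slide_right[of "g \<otimes> p" f] p e f J(1)
      by simp_all
    then have "is_join M star {e \<otimes> p, f \<otimes> p} (g \<otimes> p \<otimes> h)"
      using projection_join_mult(1)[OF _ _ h, of "g \<otimes> p"] p e f J(1) by simp
    then have "g \<otimes> p \<otimes> h = g \<otimes> p"
      using projection_join_mult(2)[OF e f g p] is_join_unique by blast
    then have "star (g \<otimes> p) \<otimes> h = star (g \<otimes> p)"
      using star_mult_projection[of "g \<otimes> p" h] p J(1) hp by simp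
    then have "h \<in> H"
      using prime_upward[OF H gH hp] projection_commute[of h "star (g \<otimes> p)"] p J(1) hp by simp
    then show ?thesis using primeD(5)[OF H _ _ _ h] p e f by simp
  qed
  show ?thesis
    unfolding prime_def
  proof (intro conjI ballI impI)
    show "push p H \<subseteq> projections" unfolding push_def by blast
    show "\<one> \<in> push p H" unfolding push_def using p pH by simp
    show "zero \<notin> push p H" unfolding push_def using p zero_mult(1) primeD(3)[OF H] by simp
    show "e \<otimes> f \<in> push p H \<longleftrightarrow> e \<in> push p H \<and> f \<in> push p H"
      if "e \<in> projections" "f \<in> projections" for e f
      using that mult unfolding push_def by simp
    show "e \<in> push p H \<or> f \<in> push p H"
      if "e \<in> projections" "f \<in> projections" "g \<in> push p H" "is_join M star {e, f} g" for e f g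
      using that join[of e f g] unfolding push_def by simp
  qed
qed

text \<open>A prime pull contains \<open>\<one>\<close>, which certifies that \<open>p\<close> is
  defined at \<open>K\<close>.\<close>

lemma pls_in_prime_if_pull:
  assumes "p \<in> carrier M" "prime (pull p K)"
  shows "pls p \<in> K"
  using primeD(2)[OF assms(2)] assms(1) unfolding pull_def by simp

lemma pull_star:
  assumes "p \<in> carrier M" "prime (pull p K)"
  shows "star p \<in> pull p K"
  using pls_in_prime_if_pull[OF assms] assms(1) A4(1) unfolding pull_def by simp

lemma prime_pls_mult:
  assumes "prime H" "s \<in> carrier M" "t \<in> carrier M" "pls (s \<otimes> t) \<in> H"
  shows "pls s \<in> H"
  using prime_upward[OF assms(1,4)] pls_mult_absorb[OF assms(2,3)] assms(2) by simp

end

section \<open>The action on germs of fractions\<close>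

text \<open>The working form of the hypothesis: the common multiple is an equation in
  \<open>M\<close> itself, not one after restriction to some \<open>e \<in> F\<close>, and
  \<open>star (c \<otimes> a) \<in> F\<close> says that it does not vanish at
  \<open>F\<close>.\<close>

locale ore_boolean_ample_monoid = boolean_ample_monoid +
  assumes ore: "\<lbrakk>prime F; a \<in> carrier M; b \<in> carrier M; star a \<in> F; star b \<in> F\<rbrakk>
    \<Longrightarrow> \<exists>c\<in>carrier M. \<exists>d\<in>carrier M. c \<otimes> a = d \<otimes> b \<and> star (c \<otimes> a) \<in> F"
begin

text \<open>The triple \<open>(z, w, H)\<close> stands for the germ at \<open>H\<close> of the fraction \<open>z\<inverse>w\<close>.\<close>

definition fractions :: "('a \<times> 'a \<times> 'a set) set" where
  "fractions = {(z, w, H). z \<in> carrier M \<and> w \<in> carrier M \<and> prime H \<and> pls z \<in> H \<and> pls w \<in> H}"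

text \<open>Both fractions are expanded by \<open>p\<close> and \<open>q\<close> to a common one at
  \<open>K\<close>. The multipliers are defined there because their pulls \<open>H\<close> and
  \<open>H'\<close> are prime.\<close>

definition fraction_rel :: "('a \<times> 'a \<times> 'a set) rel" where
  "fraction_rel = {((z, w, H), (z', w', H')). (z, w, H) \<in> fractions \<and> (z', w', H') \<in> fractions \<and>
     (\<exists>p\<in>carrier M. \<exists>q\<in>carrier M. \<exists>K. prime K \<and> pull p K = H \<and> pull q K = H' \<and>
        p \<otimes> z = q \<otimes> z' \<and> p \<otimes> w = q \<otimes> w')}"

lemma fraction_relI:
  assumes "(z, w, H) \<in> fractions" "(z', w', H') \<in> fractions" "p \<in> carrier M" "q \<in> carrier M"
    "prime K" "pull p K = H" "pull q K = H'" "p \<otimes> z = q \<otimes> z'" "p \<otimes> w = q \<otimes> w'"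
  shows "((z, w, H), (z', w', H')) \<in> fraction_rel"
  using assms unfolding fraction_rel_def by blast

lemma fraction_relE:
  assumes "((z, w, H), (z', w', H')) \<in> fraction_rel"
  obtains p q K where "p \<in> carrier M" "q \<in> carrier M" "prime K" "pull p K = H" "pull q K = H'"
    "p \<otimes> z = q \<otimes> z'" "p \<otimes> w = q \<otimes> w'"
  using assms unfolding fraction_rel_def by blast

lemma fractionD:
  assumes "(z, w, H) \<in> fractions"
  shows "z \<in> carrier M" "w \<in> carrier M" "prime H" "pls z \<in> H" "pls w \<in> H"
  using assms unfolding fractions_def by auto

lemma fractionI:
  "\<lbrakk>z \<in> carrier M; w \<in> carrier M; prime H; pls z \<in> H; pls w \<in> H\<rbrakk> \<Longrightarrow> (z, w, H) \<in> fractions"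
  unfolding fractions_def by auto

text \<open>The Ore condition at \<open>H2\<close> gives a common multiple
  \<open>c \<otimes> q = d \<otimes> r\<close> of the two multipliers of the middle fraction; the
  outer fractions are then expanded by \<open>c \<otimes> p\<close> and
  \<open>d \<otimes> s\<close>.\<close>

lemma fraction_rel_trans:
  assumes "((z1, w1, H1), (z2, w2, H2)) \<in> fraction_rel" "((z2, w2, H2), (z3, w3, H3)) \<in> fraction_rel"
  shows "((z1, w1, H1), (z3, w3, H3)) \<in> fraction_rel"
proof -
  have X: "(z1, w1, H1) \<in> fractions" "(z2, w2, H2) \<in> fractions" "(z3, w3, H3) \<in> fractions"
    using assms unfolding fraction_rel_def by auto
  note X1 = fractionD[OF X(1)] and X2 = fractionD[OF X(2)] and X3 = fractionD[OF X(3)]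
  obtain p q K where 1: "p \<in> carrier M" "q \<in> carrier M" "prime K" "pull p K = H1" "pull q K = H2"
    "p \<otimes> z1 = q \<otimes> z2" "p \<otimes> w1 = q \<otimes> w2"
    using assms(1) by (rule fraction_relE)
  obtain r s L where 2: "r \<in> carrier M" "s \<in> carrier M" "prime L" "pull r L = H2" "pull s L = H3"
    "r \<otimes> z2 = s \<otimes> z3" "r \<otimes> w2 = s \<otimes> w3"
    using assms(2) by (rule fraction_relE)
  have q: "star q \<in> H2" "pls q \<in> K" and r: "star r \<in> H2" "pls r \<in> L"
    using pull_star[of q K] pull_star[of r L] pls_in_prime_if_pull[of q K]
      pls_in_prime_if_pull[of r L] 1 2 X2(3) by auto
  obtain c d where cd: "c \<in> carrier M" "d \<in> carrier M" "c \<otimes> q = d \<otimes> r" "star (c \<otimes> q) \<in> H2"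
    using ore[OF X2(3) 1(2) 2(1) q(1) r(1)] by blast
  \<comment> \<open>The filter at which the expanded fractions meet: \<open>c\<close> pulls it to
    \<open>K\<close> and \<open>d\<close> pulls it to \<open>L\<close>.\<close>
  let ?N = "push (c \<otimes> q) H2"
  have N: "prime ?N" using prime_push[OF _ X2(3) cd(4)] cd(1) 1(2) by blast
  have "pull c ?N = K"
    using pull_push_mult[OF cd(1) 1(2) X2(3) cd(4)] push_pull[OF 1(2,3) q(2)] 1(5) by simp
  then have "pull (c \<otimes> p) ?N = H1" using pull_mult cd 1 by simp
  moreover have "pull d ?N = L"
    using pull_push_mult[OF cd(2) 2(1) X2(3)] push_pull[OF 2(1,3) r(2)] 2(4) cd(3,4) by simp
  then have "pull (d \<otimes> s) ?N = H3" using pull_mult cd 2 by simp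
  moreover have "c \<otimes> p \<otimes> u1 = d \<otimes> s \<otimes> u3"
    if "p \<otimes> u1 = q \<otimes> u2" "r \<otimes> u2 = s \<otimes> u3" "u1 \<in> carrier M" "u2 \<in> carrier M" "u3 \<in> carrier M"
    for u1 u2 u3
  proof -
    have "c \<otimes> p \<otimes> u1 = c \<otimes> q \<otimes> u2"
      using that m_assoc[of c p u1] m_assoc[of c q u2] cd(1) 1(1,2) by simp
    also have "\<dots> = d \<otimes> s \<otimes> u3" using that cd(1,2) 2 unfolding cd(3) by (simp add: m_assoc)
    finally show ?thesis .
  qed
  ultimately show ?thesis
    using fraction_relI[OF X(1,3), of "c \<otimes> p" "d \<otimes> s" ?N] cd 1 2 N X1 X2 X3 by simp
qed

lemma equiv_fraction_rel: "equiv fractions fraction_rel"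
proof (rule equivI)
  show "fraction_rel \<subseteq> fractions \<times> fractions" unfolding fraction_rel_def by auto
  show "refl_on fractions fraction_rel"
  proof (rule refl_onI)
    fix x assume x: "x \<in> fractions"
    obtain z w H where [simp]: "x = (z, w, H)" by (cases x)
    show "(x, x) \<in> fraction_rel"
      using x fractionD(3)[of z w H] pull_one fraction_relI[of z w H z w H \<one> \<one> H] by simp
  qed
  show "sym fraction_rel" unfolding sym_def fraction_rel_def by fastforce
  show "trans fraction_rel" unfolding trans_def using fraction_rel_trans by (metis prod_cases3)
qed

abbreviation germ :: "'a \<Rightarrow> 'a \<Rightarrow> 'a set \<Rightarrow> ('a \<times> 'a \<times> 'a set) set" where
  "germ z w H \<equiv> fraction_rel `` {(z, w, H)}"

lemma germ_eq_iff:
  "\<lbrakk>(z, w, H) \<in> fractions; (z', w', H') \<in> fractions\<rbrakk>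
    \<Longrightarrow> germ z w H = germ z' w' H' \<longleftrightarrow> ((z, w, H), (z', w', H')) \<in> fraction_rel"
  using eq_equiv_class_iff[OF equiv_fraction_rel] by simp

section \<open>The representation by partial bijections\<close>

definition act :: "'a \<Rightarrow> ('a \<times> 'a \<times> 'a set) set rel" where
  "act s = {(germ z w H, germ (z \<otimes> s) w H) | z w H. (z, w, H) \<in> fractions \<and> pls (z \<otimes> s) \<in> H}"

lemma fraction_mult:
  "\<lbrakk>(z, w, H) \<in> fractions; s \<in> carrier M; pls (z \<otimes> s) \<in> H\<rbrakk> \<Longrightarrow> (z \<otimes> s, w, H) \<in> fractions"
  unfolding fractions_def by auto

text \<open>Makes \<open>act\<close> independent of representatives: at \<open>K\<close> both domain
  conditions concern the same element
  \<open>p \<otimes> (z \<otimes> s) = q \<otimes> (z' \<otimes> s)\<close>.\<close>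

lemma fraction_rel_mult:
  assumes R: "((z, w, H), (z', w', H')) \<in> fraction_rel" and s: "s \<in> carrier M"
    and H': "pls (z' \<otimes> s) \<in> H'"
  shows "pls (z \<otimes> s) \<in> H" "((z \<otimes> s, w, H), (z' \<otimes> s, w', H')) \<in> fraction_rel"
proof -
  have X: "(z, w, H) \<in> fractions" "(z', w', H') \<in> fractions"
    using R unfolding fraction_rel_def by auto
  note Z = fractionD[OF X(1)] fractionD[OF X(2)]
  obtain p q K where 1: "p \<in> carrier M" "q \<in> carrier M" "prime K" "pull p K = H" "pull q K = H'"
    "p \<otimes> z = q \<otimes> z'" "p \<otimes> w = q \<otimes> w'"
    using R by (rule fraction_relE)
  have eq: "p \<otimes> (z \<otimes> s) = q \<otimes> (z' \<otimes> s)"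
    using 1 Z s by (simp flip: m_assoc)
  have "pls (q \<otimes> (z' \<otimes> s)) \<in> K"
    using H' 1 Z s A5(2)[of q "z' \<otimes> s"] unfolding pull_def by auto
  then have "pls (p \<otimes> pls (z \<otimes> s)) \<in> K"
    using eq 1 Z s A5(2)[of p "z \<otimes> s"] by simp
  then show "pls (z \<otimes> s) \<in> H"
    using 1 Z s unfolding pull_def by auto
  then show "((z \<otimes> s, w, H), (z' \<otimes> s, w', H')) \<in> fraction_rel"
    using fraction_relI[OF fraction_mult fraction_mult, of z w H s z' w' H' s p q K] X s H' 1 eq
    by simp
qed

lemma germ_act_iff:
  assumes X: "(z, w, H) \<in> fractions" and s: "s \<in> carrier M"
  shows "(germ z w H, y) \<in> act s \<longleftrightarrow> pls (z \<otimes> s) \<in> H \<and> y = germ (z \<otimes> s) w H"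
proof
  assume "(germ z w H, y) \<in> act s"
  then obtain z' w' H' where 1: "(z', w', H') \<in> fractions" "pls (z' \<otimes> s) \<in> H'"
    "germ z w H = germ z' w' H'" "y = germ (z' \<otimes> s) w' H'"
    unfolding act_def by blast
  then have R: "((z, w, H), (z', w', H')) \<in> fraction_rel" using germ_eq_iff X by blast
  note R' = fraction_rel_mult[OF R s 1(2)]
  then show "pls (z \<otimes> s) \<in> H \<and> y = germ (z \<otimes> s) w H"
    using germ_eq_iff[OF fraction_mult[OF X s] fraction_mult[OF 1(1) s 1(2)]] 1(4) by simp
next
  assume "pls (z \<otimes> s) \<in> H \<and> y = germ (z \<otimes> s) w H"
  then show "(germ z w H, y) \<in> act s" using X unfolding act_def by blast
qed

lemma actE:
  assumes "(x, y) \<in> act s"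
  obtains z w H where "(z, w, H) \<in> fractions" "pls (z \<otimes> s) \<in> H" "x = germ z w H" "y = germ (z \<otimes> s) w H"
  using assms unfolding act_def by blast

lemma act_mult:
  assumes s: "s \<in> carrier M" and t: "t \<in> carrier M"
  shows "act (s \<otimes> t) = act s O act t"
proof (intro equalityI subrelI)
  fix x y assume "(x, y) \<in> act (s \<otimes> t)"
  then obtain z w H where X: "(z, w, H) \<in> fractions" and H: "pls (z \<otimes> (s \<otimes> t)) \<in> H"
    and xy: "x = germ z w H" "y = germ (z \<otimes> (s \<otimes> t)) w H"
    by (rule actE)
  note Z = fractionD[OF X]
  have assoc: "z \<otimes> (s \<otimes> t) = z \<otimes> s \<otimes> t" using Z s t by (simp add: m_assoc)
  then have zs: "pls (z \<otimes> s) \<in> H" using prime_pls_mult[of H "z \<otimes> s" t] H Z s t by simp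
  then have "(x, germ (z \<otimes> s) w H) \<in> act s" using germ_act_iff X s xy by simp
  moreover have "(germ (z \<otimes> s) w H, y) \<in> act t"
    using germ_act_iff[OF fraction_mult[OF X s zs] t] H xy assoc by simp
  ultimately show "(x, y) \<in> act s O act t" by blast
next
  fix x y assume "(x, y) \<in> act s O act t"
  then obtain u where u: "(x, u) \<in> act s" "(u, y) \<in> act t" by blast
  then obtain z w H where X: "(z, w, H) \<in> fractions" and zs: "pls (z \<otimes> s) \<in> H"
    and xu: "x = germ z w H" "u = germ (z \<otimes> s) w H"
    by (elim actE)
  note Z = fractionD[OF X]
  have assoc: "z \<otimes> (s \<otimes> t) = z \<otimes> s \<otimes> t" using Z s t by (simp add: m_assoc)
  have "pls (z \<otimes> s \<otimes> t) \<in> H \<and> y = germ (z \<otimes> s \<otimes> t) w H"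
    using germ_act_iff[OF fraction_mult[OF X s zs] t] u(2) xu by simp
  then show "(x, y) \<in> act (s \<otimes> t)" using germ_act_iff[OF X, of "s \<otimes> t"] xu s t assoc by simp
qed

text \<open>(A7) cancels \<open>s\<close> only up to a factor \<open>pls s\<close> on the right.
  Slid to the left, this factor becomes the same \<open>?k \<in> K\<close> on both sides and is
  absorbed into the multipliers, whose pulls it does not change.\<close>

lemma fraction_rel_cancel:
  assumes X: "(z, w, H) \<in> fractions" "(z', w', H') \<in> fractions" and s: "s \<in> carrier M"
    and H: "pls (z \<otimes> s) \<in> H"
    and R: "((z \<otimes> s, w, H), (z' \<otimes> s, w', H')) \<in> fraction_rel"
  shows "((z, w, H), (z', w', H')) \<in> fraction_rel"
proof -
  note Z = fractionD[OF X(1)] fractionD[OF X(2)]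
  obtain p q K where 1: "p \<in> carrier M" "q \<in> carrier M" "prime K" "pull p K = H" "pull q K = H'"
    "p \<otimes> (z \<otimes> s) = q \<otimes> (z' \<otimes> s)" "p \<otimes> w = q \<otimes> w'"
    using R by (rule fraction_relE)
  let ?k = "pls (p \<otimes> (z \<otimes> s))"
  have k: "?k \<in> K" using H 1 Z s A5(2)[of p "z \<otimes> s"] unfolding pull_def by auto
  have "p \<otimes> z \<otimes> pls s = q \<otimes> z' \<otimes> pls s"
    using A7(1)[of "p \<otimes> z" "q \<otimes> z'" s] 1 Z s by (simp add: m_assoc)
  moreover have slide: "u \<otimes> pls s = pls (u \<otimes> s) \<otimes> u" if "u \<in> carrier M" for u
    using A6(2)[of u s] A5(2)[of u s] that s by simp
  ultimately have "?k \<otimes> (p \<otimes> z) = ?k \<otimes> (q \<otimes> z')"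
    using slide[of "p \<otimes> z"] slide[of "q \<otimes> z'"] 1 Z s by (simp add: m_assoc)
  moreover have "pull (?k \<otimes> p) K = H" "pull (?k \<otimes> q) K = H'"
    using pull_mult pull_projection[OF 1(3) k] 1 Z s by simp_all
  ultimately show ?thesis
    using fraction_relI[OF X, of "?k \<otimes> p" "?k \<otimes> q" K] 1 Z s by (simp add: m_assoc)
qed

lemma biunique_act:
  assumes s: "s \<in> carrier M"
  shows "biunique (act s)"
proof (rule biuniqueI)
  fix x y y' assume 1: "(x, y) \<in> act s" "(x, y') \<in> act s"
  from 1(1) obtain z w H where "(z, w, H) \<in> fractions" "x = germ z w H" by (rule actE)
  then show "y = y'" using 1 germ_act_iff s by simp
next
  fix x x' y assume 1: "(x, y) \<in> act s" "(x', y) \<in> act s"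
  from 1(1) obtain z w H where X: "(z, w, H) \<in> fractions" "pls (z \<otimes> s) \<in> H" "x = germ z w H"
    "y = germ (z \<otimes> s) w H" by (rule actE)
  from 1(2) obtain z' w' H' where X': "(z', w', H') \<in> fractions" "pls (z' \<otimes> s) \<in> H'" "x' = germ z' w' H'"
    "y = germ (z' \<otimes> s) w' H'" by (rule actE)
  have "((z \<otimes> s, w, H), (z' \<otimes> s, w', H')) \<in> fraction_rel"
    using germ_eq_iff[OF fraction_mult[OF X(1) s X(2)] fraction_mult[OF X'(1) s X'(2)]] X(4) X'(4) by simp
  then show "x = x'"
    using fraction_rel_cancel[OF X(1) X'(1) s X(2)] germ_eq_iff[OF X(1) X'(1)] X(3) X'(3) by simp
qed

lemma germ_act_projection_iff:
  assumes X: "(z, w, H) \<in> fractions" and e: "e \<in> projections"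
  shows "(germ z w H, y) \<in> act e \<longleftrightarrow> pls (z \<otimes> e) \<in> H \<and> y = germ z w H"
proof -
  note Z = fractionD[OF X]
  have "germ (z \<otimes> e) w H = germ z w H" if k: "pls (z \<otimes> e) \<in> H"
  proof -
    let ?k = "pls (z \<otimes> e)"
    \<comment> \<open>Both products equal \<open>z \<otimes> e\<close>, so \<open>?k\<close> serves
      as multiplier on both sides at the filter \<open>H\<close> itself.\<close>
    have "?k \<otimes> (z \<otimes> e) = ?k \<otimes> z"
      using A4(2)[of "z \<otimes> e"] projection_slide_left[of z e] Z e by simp
    then have "((z \<otimes> e, w, H), (z, w, H)) \<in> fraction_rel"
      using fraction_relI[OF fraction_mult[OF X _ k] X, of ?k ?k H] Z e pull_projection[OF Z(3) k] by simp
    then show ?thesis using germ_eq_iff[OF fraction_mult[OF X _ k] X] e by simp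
  qed
  then show ?thesis using germ_act_iff[OF X, of e] e by auto
qed

lemma act_projection_subset_Id:
  assumes "e \<in> projections"
  shows "act e \<subseteq> Id"
proof (rule subrelI)
  fix x y assume xy: "(x, y) \<in> act e"
  then obtain z w H where "(z, w, H) \<in> fractions" "x = germ z w H" by (rule actE)
  then show "(x, y) \<in> Id" using xy germ_act_projection_iff assms by simp
qed

text \<open>Domains agree because (A5) gives
  \<open>pls (z \<otimes> s) = pls (z \<otimes> pls s)\<close>; no common multiples enter here, in
  contrast to ranges.\<close>

lemma act_pls:
  assumes s: "s \<in> carrier M"
  shows "act s O (act s)\<inverse> = act (pls s)"
proof -
  have iff: "germ z w H \<in> Domain (act s) \<longleftrightarrow> (germ z w H, germ z w H) \<in> act (pls s)"
    if X: "(z, w, H) \<in> fractions" for z w H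
    using germ_act_iff[OF X s] germ_act_projection_iff[OF X, of "pls s"] A5(2)[of z s] fractionD[OF X] s
    by (auto simp: Domain_unfold)
  \<comment> \<open>A value \<open>x\<close> of the point type need not be a germ; occurring in some
    \<open>act t\<close> supplies a representative.\<close>
  have "x \<in> Domain (act s) \<longleftrightarrow> (x, x) \<in> act (pls s)" if "(x, y) \<in> act t" for x y t
    using that iff by (elim actE) simp
  then have "x \<in> Domain (act s) \<longleftrightarrow> (x, x) \<in> act (pls s)" for x
    by blast
  then have "Id_on (Domain (act s)) = act (pls s)"
    using act_projection_subset_Id[of "pls s"] s by auto
  then show ?thesis using biunique_relcomp_converse[OF biunique_act[OF s]] by simp
qed

text \<open>For the inclusion from right to left, the Ore condition at \<open>pull z H\<close> gives \<open>c \<otimes> s = d \<otimes> z\<close>, so that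
  the germ of \<open>z\<inverse>w\<close> is that of \<open>(cs)\<inverse>(dw)\<close>, a value of \<open>act s\<close>.\<close>

lemma act_star:
  assumes s: "s \<in> carrier M"
  shows "(act s)\<inverse> O act s = act (star s)"
proof -
  have "y \<in> Range (act s) \<longleftrightarrow> (y, y) \<in> act (star s)" for y
  proof
    assume "y \<in> Range (act s)"
    then obtain x where "(x, y) \<in> act s" by blast
    then obtain z w H where X: "(z, w, H) \<in> fractions" "pls (z \<otimes> s) \<in> H" "y = germ (z \<otimes> s) w H"
      by (rule actE)
    note Z = fractionD[OF X(1)]
    show "(y, y) \<in> act (star s)"
      using germ_act_projection_iff[OF fraction_mult[OF X(1) s X(2)], of "star s"] X Z s A4(1)[of s]
      by (simp add: m_assoc)
  next
    assume y: "(y, y) \<in> act (star s)"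
    then obtain z w H where X: "(z, w, H) \<in> fractions" and zs: "pls (z \<otimes> star s) \<in> H" and yz: "y = germ z w H"
      by (rule actE)
    note Z = fractionD[OF X]
    let ?F = "pull z H"
    have F: "prime ?F" using prime_pull Z by simp
    have "star s \<in> ?F" "star z \<in> ?F" using zs pull_star[OF Z(1) F] s unfolding pull_def by simp_all
    then obtain c d where cd: "c \<in> carrier M" "d \<in> carrier M" "c \<otimes> s = d \<otimes> z" "star (c \<otimes> s) \<in> ?F"
      using ore[OF F s Z(1)] by blast
    have "star d \<otimes> pls z \<in> H"
    proof -
      have "pls (z \<otimes> star (d \<otimes> z)) \<in> H" using cd unfolding pull_def by simp
      moreover have "z \<otimes> star (d \<otimes> z) = star d \<otimes> z" using A6(1)[of z d] Z cd by simp
      ultimately show ?thesis using pls_projection_mult[of z "star d"] Z cd by simp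
    qed
    then have dH: "star d \<in> H" using primeD(4)[OF Z(3)] Z cd by simp
    \<comment> \<open>The filter for the new fraction: since \<open>d\<close> pulls it to
      \<open>H\<close>, the multipliers \<open>\<one>\<close> and \<open>d\<close> identify the two
      germs.\<close>
    let ?K = "push d H"
    have K: "prime ?K" and dK: "pull d ?K = H" using prime_push pull_push cd(2) Z(3) dH by simp_all
    have push: "pls (d \<otimes> u) \<in> ?K" if u: "u \<in> carrier M" "pls u \<in> H" for u
    proof -
      have "pls u \<in> pull d ?K" using u dK by simp
      then show ?thesis using A5(2)[of d u] u cd(2) unfolding pull_def by simp
    qed
    have cs: "pls (c \<otimes> s) \<in> ?K" using push[OF Z(1,4)] cd(3) by simp
    have "(c, d \<otimes> w, ?K) \<in> fractions"
      using fractionI prime_pls_mult[OF K cd(1) s cs] push[OF Z(2,5)] cd Z K by simp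
    note C = this fraction_mult[OF this s cs]
    have "((c \<otimes> s, d \<otimes> w, ?K), (z, w, H)) \<in> fraction_rel"
      using fraction_relI[OF C(2) X, of \<one> d ?K] cd Z K dK pull_one s by simp
    then have "germ (c \<otimes> s) (d \<otimes> w) ?K = y" using germ_eq_iff[OF C(2) X] yz by simp
    then have "(germ c (d \<otimes> w) ?K, y) \<in> act s" using germ_act_iff[OF C(1) s] cs by simp
    then show "y \<in> Range (act s)" by blast
  qed
  then have "Id_on (Range (act s)) = act (star s)"
    using act_projection_subset_Id[of "star s"] s by auto
  then show ?thesis using biunique_converse_relcomp[OF biunique_act[OF s]] by simp
qed

lemma act_zero: "act zero = {}"
proof -
  have False if xy: "(x, y) \<in> act zero" for x y
  proof -
    obtain z w H where X: "(z, w, H) \<in> fractions" and H: "pls (z \<otimes> zero) \<in> H"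
      using xy by (rule actE)
    then show False using fractionD(1,3)[OF X] primeD(3)[of H] zero_mult(2) by simp
  qed
  then show ?thesis by auto
qed

text \<open>A projection fixes the germ of \<open>(z, w, H)\<close> exactly if it lies in
  \<open>pull z H\<close>, and this filter is prime.\<close>

lemma act_join:
  assumes e: "e \<in> projections" and f: "f \<in> projections" and g: "is_join M star {e, f} g"
  shows "act g = act e \<union> act f"
proof -
  have gp: "g \<in> projections" using is_join_projection(1)[OF e f g] .
  have germs: "(germ z w H, y) \<in> act g \<longleftrightarrow> (germ z w H, y) \<in> act e \<union> act f"
    if X: "(z, w, H) \<in> fractions" for z w H y
  proof -
    note Z = fractionD[OF X]
    have "g \<in> pull z H \<longleftrightarrow> e \<in> pull z H \<or> f \<in> pull z H"
      using prime_join_iff[OF prime_pull e f g] Z by simp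
    then show ?thesis
      using germ_act_projection_iff[OF X] e f gp unfolding pull_def by auto
  qed
  have "(x, y) \<in> act g \<longleftrightarrow> (x, y) \<in> act e \<union> act f" if "(x, y) \<in> act s" for x y s
    using that germs by (elim actE) simp
  then show ?thesis by auto
qed

text \<open>Faithfulness as a separation argument: if \<open>s\<close> and
  \<open>pls s \<otimes> t\<close> differed, a prime filter \<open>H\<close> containing
  \<open>pls s\<close> would avoid every projection on which \<open>s\<close> and \<open>t\<close>
  agree, contradicting equality of their values at the germ of
  \<open>(\<one>, \<one>, H)\<close>.\<close>

lemma act_subset:
  assumes s: "s \<in> carrier M" and t: "t \<in> carrier M" and sub: "act s \<subseteq> act t"
  shows "s = pls s \<otimes> t"
proof -
  define I where "I = {h \<in> projections. h \<otimes> s = h \<otimes> t}"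
  have I: "projection_ideal I"
    unfolding projection_ideal_def
  proof (intro conjI ballI allI impI)
    show "I \<subseteq> projections" unfolding I_def by blast
    show "zero \<in> I" unfolding I_def using zero_mult s t by simp
  next
    fix e f assume e: "e \<in> I" and f: "f \<in> projections"
    then have "e \<otimes> f = f \<otimes> e" using projection_commute[of e f] unfolding I_def by simp
    then show "e \<otimes> f \<in> I" using e f s t unfolding I_def by (simp add: m_assoc)
  next
    fix e f g assume ef: "e \<in> I" "f \<in> I" and g: "is_join M star {e, f} g"
    then have p: "e \<in> projections" "f \<in> projections" and eq: "e \<otimes> s = e \<otimes> t" "f \<otimes> s = f \<otimes> t"
      unfolding I_def by auto
    have "g \<otimes> s = g \<otimes> t"
      using projection_join_mult(2)[OF p g s] projection_join_mult(2)[OF p g t] is_join_unique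
      unfolding eq by blast
    then show "g \<in> I" using is_join_projection(1)[OF p g] unfolding I_def by simp
  qed
  have "pls s \<in> I"
  proof (rule ccontr)
    assume "pls s \<notin> I"
    then obtain H where H: "prime H" "pls s \<in> H" "H \<inter> I = {}"
      using prime_filter_exists[OF I, of "pls s"] s by auto
    have X: "(\<one>, \<one>, H) \<in> fractions" using fractionI primeD(2)[OF H(1)] H(1) by simp
    have "(germ \<one> \<one> H, germ s \<one> H) \<in> act t"
      using germ_act_iff[OF X s] H(2) s sub by auto
    then have tH: "pls t \<in> H" and eq: "germ s \<one> H = germ t \<one> H"
      using germ_act_iff[OF X t] t by auto
    have "((s, \<one>, H), (t, \<one>, H)) \<in> fraction_rel"
      using germ_eq_iff fraction_mult[OF X s] fraction_mult[OF X t] H(2) tH s t eq by simp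
    then obtain p q K where 1: "p \<in> carrier M" "q \<in> carrier M" "prime K" "pull p K = H"
      "p \<otimes> s = q \<otimes> t" "p \<otimes> \<one> = q \<otimes> \<one>"
      by (rule fraction_relE)
    \<comment> \<open>The numerators \<open>\<one>\<close> force \<open>p = q\<close>, so (A7)
      cancels \<open>p\<close>.\<close>
    then have "star p \<otimes> s = star p \<otimes> t" using A7(2)[of s t p] s t by simp
    then have "star p \<in> I" using 1 unfolding I_def by simp
    moreover have "star p \<in> H" using pull_star[of p K] 1 H(1) by simp
    ultimately show False using H(3) by blast
  qed
  then show ?thesis using A4(2)[OF s] unfolding I_def by simp
qed

lemma act_inj:
  assumes s: "s \<in> carrier M" and t: "t \<in> carrier M" and eq: "act s = act t"
  shows "s = t"
proof -
  have st: "s = pls s \<otimes> t" "t = pls t \<otimes> s" using act_subset s t eq by auto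
  have "pls s = pls s \<otimes> pls t" using pls_projection_mult[of t "pls s"] st(1) s t by simp
  moreover have "pls t = pls t \<otimes> pls s" using pls_projection_mult[of s "pls t"] st(2) s t by simp
  ultimately have "pls s = pls t" using projection_commute[of "pls s" "pls t"] s t by simp
  then show ?thesis using st(1) A4(2)[OF t] by simp
qed

end

section \<open>The inverse monoid of fractions\<close>

context ore_boolean_ample_monoid
begin

definition rel_of :: "('a \<times> 'a) list \<Rightarrow> ('a \<times> 'a \<times> 'a set) set rel" where
  "rel_of L = (\<Union>(a, b)\<in>set L. (act a)\<inverse> O act b)"

definition fractional :: "('a \<times> 'a \<times> 'a set) set rel \<Rightarrow> bool" where
  "fractional r \<longleftrightarrow> (\<exists>L. set L \<subseteq> carrier M \<times> carrier M \<and> rel_of L = r)"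

lemma fractional_empty: "fractional {}"
  unfolding fractional_def rel_of_def by (rule exI[of _ "[]"]) simp

lemma fractional_fraction: "\<lbrakk>a \<in> carrier M; b \<in> carrier M\<rbrakk> \<Longrightarrow> fractional ((act a)\<inverse> O act b)"
  unfolding fractional_def rel_of_def by (rule exI[of _ "[(a, b)]"]) simp

lemma fractional_Un:
  assumes "fractional r" "fractional s"
  shows "fractional (r \<union> s)"
proof -
  obtain L N where "set L \<subseteq> carrier M \<times> carrier M" "rel_of L = r"
    "set N \<subseteq> carrier M \<times> carrier M" "rel_of N = s"
    using assms unfolding fractional_def by blast
  then show ?thesis
    unfolding fractional_def by (intro exI[of _ "L @ N"]) (auto simp: rel_of_def)
qed

lemma fractional_induct [consumes 1, case_names empty fraction union]:
  assumes "fractional r" and "P {}"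
    and "\<And>a b. \<lbrakk>a \<in> carrier M; b \<in> carrier M\<rbrakk> \<Longrightarrow> P ((act a)\<inverse> O act b)"
    and "\<And>r s. \<lbrakk>P r; P s\<rbrakk> \<Longrightarrow> P (r \<union> s)"
  shows "P r"
proof -
  have "P (rel_of L)" if "set L \<subseteq> carrier M \<times> carrier M" for L
    using that
  proof (induction L)
    case Nil
    then show ?case using assms(2) by (simp add: rel_of_def)
  next
    case (Cons x L)
    obtain a b where [simp]: "x = (a, b)" by (cases x)
    have "rel_of (x # L) = (act a)\<inverse> O act b \<union> rel_of L" by (simp add: rel_of_def)
    then show ?case using Cons assms(3,4) by simp
  qed
  then show ?thesis using assms(1) unfolding fractional_def by blast
qed

lemma act_projection_converse: "e \<in> projections \<Longrightarrow> (act e)\<inverse> = act e"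
  using act_projection_subset_Id[of e] by auto

text \<open>\<open>act \<one>\<close> is the identity on germs only, so neutrality is checked on
  fractions.\<close>

lemma act_one_left: "fractional r \<Longrightarrow> act \<one> O r = r"
proof (induction rule: fractional_induct)
  case (fraction a b)
  have "act \<one> O (act a)\<inverse> = (act a O act \<one>)\<inverse>"
    by (simp add: converse_relcomp act_projection_converse)
  also have "\<dots> = (act a)\<inverse>" using act_mult[of a \<one>] fraction by simp
  finally show ?case by (simp flip: O_assoc)
qed auto

lemma act_one_right: "fractional r \<Longrightarrow> r O act \<one> = r"
proof (induction rule: fractional_induct)
  case (fraction a b)
  then show ?case using act_mult[of b \<one>] by (simp add: O_assoc)
qed auto

lemma fractional_act: "s \<in> carrier M \<Longrightarrow> fractional (act s)"
  using fractional_fraction[of \<one> s] act_mult[of \<one> s] by (simp add: act_projection_converse)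

lemma fractional_converse: "fractional r \<Longrightarrow> fractional (r\<inverse>)"
proof (induction rule: fractional_induct)
  case (fraction a b)
  then show ?case using fractional_fraction[of b a] by (simp add: converse_relcomp)
qed (simp_all add: fractional_empty converse_Un fractional_Un)

lemma fractional_sandwich:
  assumes "fractional r" and c: "c \<in> carrier M" and d: "d \<in> carrier M"
  shows "fractional ((act c)\<inverse> O r O act d)"
  using assms(1)
proof (induction rule: fractional_induct)
  case (fraction a b)
  have "(act c)\<inverse> O ((act a)\<inverse> O act b) O act d = (act (a \<otimes> c))\<inverse> O act (b \<otimes> d)"
    using fraction c d by (simp add: act_mult converse_relcomp O_assoc)
  then show ?case using fractional_fraction[of "a \<otimes> c" "b \<otimes> d"] fraction c d by simp
qed (simp_all add: fractional_empty fractional_Un relcomp_distrib relcomp_distrib2)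

lemma fractional_relcomp_act:
  assumes "fractional r" and d: "d \<in> carrier M"
  shows "fractional (r O act d)"
  using fractional_sandwich[OF assms(1) one_closed d] act_one_left[OF assms(1)]
  by (simp add: act_projection_converse flip: O_assoc)

text \<open>Compactness: the projections \<open>e\<close> for which \<open>act b O act e O (act a)\<inverse>\<close> is a finite union of
  fractions form an ideal, which by the Ore condition meets every prime filter containing
  \<open>star b \<otimes> star a\<close>.\<close>

lemma fractional_act_converse:
  assumes a: "a \<in> carrier M" and b: "b \<in> carrier M"
  shows "fractional (act b O (act a)\<inverse>)"
proof -
  define I where "I = {e \<in> projections. fractional (act b O act e O (act a)\<inverse>)}"
  have I: "projection_ideal I"
    unfolding projection_ideal_def
  proof (intro conjI ballI allI impI)
    show "I \<subseteq> projections" unfolding I_def by blast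
    show "zero \<in> I" unfolding I_def by (simp add: act_zero fractional_empty)
  next
    fix e f assume e: "e \<in> I" and f: "f \<in> projections"
    \<comment> \<open>Moving \<open>f\<close> across the converse of \<open>act a\<close> turns it
      into \<open>act ?g\<close> on the far right, where composition with an action preserves finite
      unions of fractions.\<close>
    let ?g = "pls (a \<otimes> f)"
    have ep: "e \<in> projections" using e unfolding I_def by simp
    have "act f O (act a)\<inverse> = (act (a \<otimes> f))\<inverse>"
      using a f by (simp add: act_mult converse_relcomp act_projection_converse)
    also have "\<dots> = (act (?g \<otimes> a))\<inverse>"
      using projection_slide_left[of a f] a f by simp
    also have "\<dots> = (act a)\<inverse> O act ?g"
      using act_mult[of ?g a] act_projection_converse[of ?g] a f by (simp add: converse_relcomp)
    finally have "act b O act (e \<otimes> f) O (act a)\<inverse> = (act b O act e O (act a)\<inverse>) O act ?g"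
      using act_mult[of e f] ep f by (simp add: O_assoc)
    then show "e \<otimes> f \<in> I"
      using fractional_relcomp_act[of "act b O act e O (act a)\<inverse>" ?g] e ep f a
      unfolding I_def by simp
  next
    fix e f g assume ef: "e \<in> I" "f \<in> I" and g: "is_join M star {e, f} g"
    then have p: "e \<in> projections" "f \<in> projections" unfolding I_def by auto
    then show "g \<in> I"
      using ef act_join[OF p g] is_join_projection(1)[OF p g] fractional_Un
      unfolding I_def by (simp add: relcomp_distrib relcomp_distrib2)
  qed
  have "star b \<otimes> star a \<in> I"
  proof (rule ccontr)
    assume "star b \<otimes> star a \<notin> I"
    then obtain F where F: "prime F" "star b \<otimes> star a \<in> F" "F \<inter> I = {}"
      using prime_filter_exists[OF I, of "star b \<otimes> star a"] a b by auto
    then have "star b \<in> F" "star a \<in> F" using primeD(4)[OF F(1), of "star b" "star a"] a b by auto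
    then obtain c d where cd: "c \<in> carrier M" "d \<in> carrier M" "c \<otimes> b = d \<otimes> a" "star (c \<otimes> b) \<in> F"
      using ore[OF F(1) b a] by blast
    let ?e = "star (c \<otimes> b)"
    \<comment> \<open>Restricting \<open>b\<close> on the right to \<open>?e\<close> is restricting
      it on the left to \<open>star c\<close>, and \<open>act (star c)\<close> splits as
      \<open>(act c)\<inverse> O act c\<close>. So over \<open>?e\<close> the composite is a single
      fraction of \<open>c\<close> and \<open>d \<otimes> pls a\<close>.\<close>
    have "act b O act ?e = act (star c \<otimes> b)"
      using A6(1)[of b c] act_mult[of b ?e] a b cd by simp
    also have "\<dots> = (act c)\<inverse> O act (c \<otimes> b)"
      using act_mult[of "star c" b] act_mult[of c b] act_star[of c] b cd(1) by (simp flip: O_assoc)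
    also have "\<dots> = (act c)\<inverse> O act d O act a"
      using act_mult[of d a] a cd by simp
    finally have "act b O act ?e O (act a)\<inverse> = ((act c)\<inverse> O act d O act a) O (act a)\<inverse>"
      by (simp flip: O_assoc)
    also have "\<dots> = (act c)\<inverse> O act (d \<otimes> pls a)"
      using act_pls[OF a] act_mult[of d "pls a"] a cd(2) by (simp add: O_assoc)
    finally have "?e \<in> I"
      using fractional_fraction[of c "d \<otimes> pls a"] a b cd unfolding I_def by simp
    then show False using F(3) cd(4) by blast
  qed
  \<comment> \<open>The restriction to \<open>star b \<otimes> star a\<close> loses nothing, so the
    ideal yields the full composite.\<close>
  moreover have "act b O act (star b \<otimes> star a) O (act a)\<inverse> = act b O (act a)\<inverse>"
  proof -
    have b': "act b O act (star b) = act b" using act_mult[of b "star b"] A4(1) b by simp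
    have a': "act (star a) O (act a)\<inverse> = (act a)\<inverse>"
      using act_mult[of a "star a"] A4(1) a act_projection_converse[of "star a"] converse_relcomp
      by (metis star_projection star_closed)
    have "act b O act (star b \<otimes> star a) O (act a)\<inverse> =
        (act b O act (star b)) O (act (star a) O (act a)\<inverse>)"
      using act_mult[of "star b" "star a"] a b by (simp add: O_assoc)
    then show ?thesis unfolding a' b' .
  qed
  ultimately show ?thesis unfolding I_def by simp
qed

text \<open>In a product of two fractions the middle part \<open>act b O (act c)\<inverse>\<close>
  becomes a finite union of fractions, and the outer factors are absorbed into its terms.\<close>

lemma fractional_relcomp:
  assumes r: "fractional r" and s: "fractional s"
  shows "fractional (r O s)"
  using r
proof (induction rule: fractional_induct)
  case (fraction a b)
  show ?case
    using s
  proof (induction rule: fractional_induct)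
    case (fraction c d)
    then show ?case
      using fractional_sandwich[OF fractional_act_converse[of c b] \<open>a \<in> carrier M\<close>, of d]
        \<open>b \<in> carrier M\<close> by (simp add: O_assoc)
  qed (simp_all add: fractional_empty fractional_Un relcomp_distrib)
qed (simp_all add: fractional_empty fractional_Un relcomp_distrib2)

text \<open>Composing with \<open>act a\<close> on the left turns the inclusion into
  \<open>act (pls a \<otimes> b) \<subseteq> act a\<close>, which faithfulness converts into
  \<open>pls a \<otimes> b = pls b \<otimes> a\<close>. This is the source of fullness and of
  complements in \<open>T\<close>.\<close>

lemma fraction_subset_Id:
  assumes a: "a \<in> carrier M" and b: "b \<in> carrier M" and sub: "(act a)\<inverse> O act b \<subseteq> Id"
  shows "\<exists>e\<in>projections. (act a)\<inverse> O act b = act e"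
proof -
  have "act (pls a \<otimes> b) = act a O (act a)\<inverse> O act b"
    using act_mult[of "pls a" b] a b by (simp add: O_assoc flip: act_pls)
  also have "\<dots> \<subseteq> act a" using sub by blast
  finally have "pls a \<otimes> b = pls (pls a \<otimes> b) \<otimes> a"
    using act_subset[of "pls a \<otimes> b" a] a b by simp
  also have "\<dots> = pls b \<otimes> a"
    using pls_projection_mult[of b "pls a"] projection_commute[of "pls a" "pls b"] A4(2)[OF a] a b
    by (simp add: m_assoc)
  finally have ab: "pls a \<otimes> b = pls b \<otimes> a" .
  have pls_right: "(act a)\<inverse> O act (pls a) = (act a)\<inverse>"
    using act_mult[of "pls a" a] A4(2)[OF a] act_projection_converse[of "pls a"] a converse_relcomp
    by (metis pls_projection pls_closed)
  have "(act a)\<inverse> O act b = (act a)\<inverse> O act (pls a \<otimes> b)"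
    using act_mult[of "pls a" b] a b by (simp add: pls_right flip: O_assoc)
  also have "\<dots> = (act a)\<inverse> O act (pls b) O act a"
    unfolding ab using act_mult[of "pls b" a] a b by simp
  also have "\<dots> = (act a)\<inverse> O act (a \<otimes> star (pls b \<otimes> a))"
    using act_mult[of "pls b" a] projection_slide_right[of a "pls b"] a b by simp
  also have "\<dots> = act (star a \<otimes> star (pls b \<otimes> a))"
    using act_mult[of a "star (pls b \<otimes> a)"] act_mult[of "star a" "star (pls b \<otimes> a)"] act_star[OF a] a b
    by (simp flip: O_assoc)
  finally show ?thesis using a b by (metis m_closed pls_closed projection_mult star_projection)
qed

lemma fractional_subset_Id:
  assumes "fractional r" "r \<subseteq> Id"
  shows "\<exists>e\<in>projections. r = act e"
  using assms
proof (induction rule: fractional_induct)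
  case empty
  then show ?case using act_zero zero_projection by metis
next
  case (fraction a b)
  then show ?case using fraction_subset_Id by simp
next
  case (union r s)
  then obtain e f where ef: "e \<in> projections" "f \<in> projections" "r = act e" "s = act f" by auto
  obtain g where g: "is_join M star {e, f} g" using projection_join_ex ef by blast
  then show ?case using act_join[OF ef(1,2) g] is_join_projection(1)[OF ef(1,2) g] ef by blast
qed

section \<open>The monoid \<open>T\<close> and the embedding\<close>

definition encode :: "('a \<times> 'a \<times> 'a set) set rel \<Rightarrow> ('a \<times> 'a) list" where
  "encode r = (SOME L. set L \<subseteq> carrier M \<times> carrier M \<and> rel_of L = r)"

text \<open>With one chosen list per relation, \<open>rel_of\<close> is injective on the carrier and
  no quotient of lists is needed.\<close>

definition fraction_monoid :: "('a \<times> 'a) list monoid" where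
  "fraction_monoid = \<lparr>carrier = encode ` {r. fractional r \<and> biunique r},
     mult = (\<lambda>L N. encode (rel_of L O rel_of N)), one = encode (act \<one>)\<rparr>"

lemma encode:
  assumes "fractional r"
  shows "set (encode r) \<subseteq> carrier M \<times> carrier M" "rel_of (encode r) = r"
  using someI_ex[OF assms[unfolded fractional_def]] unfolding encode_def by auto

lemma fraction_monoidE:
  assumes "x \<in> carrier fraction_monoid"
  obtains r where "fractional r" "biunique r" "x = encode r" "rel_of x = r"
    "set x \<subseteq> carrier M \<times> carrier M"
  using assms encode unfolding fraction_monoid_def by auto

lemma encode_closed: "\<lbrakk>fractional r; biunique r\<rbrakk> \<Longrightarrow> encode r \<in> carrier fraction_monoid"
  unfolding fraction_monoid_def by auto

lemma rel_of_mult: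
  assumes "x \<in> carrier fraction_monoid" "y \<in> carrier fraction_monoid"
  shows "x \<otimes>\<^bsub>fraction_monoid\<^esub> y \<in> carrier fraction_monoid"
    and "rel_of (x \<otimes>\<^bsub>fraction_monoid\<^esub> y) = rel_of x O rel_of y"
proof -
  have "fractional (rel_of x O rel_of y)" "biunique (rel_of x O rel_of y)"
    using assms by (auto elim!: fraction_monoidE intro: fractional_relcomp biunique_relcomp)
  then show "x \<otimes>\<^bsub>fraction_monoid\<^esub> y \<in> carrier fraction_monoid"
    "rel_of (x \<otimes>\<^bsub>fraction_monoid\<^esub> y) = rel_of x O rel_of y"
    using encode(2) unfolding fraction_monoid_def by auto
qed

lemma encode_act:
  assumes "s \<in> carrier M"
  shows "encode (act s) \<in> carrier fraction_monoid" "rel_of (encode (act s)) = act s"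
  using encode_closed encode(2) fractional_act biunique_act assms by auto

lemma inj_rel_of: "inj_on rel_of (carrier fraction_monoid)"
  by (rule inj_onI) (auto elim!: fraction_monoidE)

lemma one_fraction_monoid: "\<one>\<^bsub>fraction_monoid\<^esub> = encode (act \<one>)"
  unfolding fraction_monoid_def by simp

sublocale fraction: biunique_representation fraction_monoid rel_of "encode {}"
proof
  note eqI = inj_onD[OF inj_rel_of]
  fix x assume x: "x \<in> carrier fraction_monoid"
  then have fx: "fractional (rel_of x)" and bx: "biunique (rel_of x)"
    by (auto elim!: fraction_monoidE)
  show "\<one>\<^bsub>fraction_monoid\<^esub> \<otimes>\<^bsub>fraction_monoid\<^esub> x = x" "x \<otimes>\<^bsub>fraction_monoid\<^esub> \<one>\<^bsub>fraction_monoid\<^esub> = x"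
    using x encode_act[of \<one>] fx
    by (auto intro!: eqI simp: rel_of_mult one_fraction_monoid act_one_left act_one_right)
  show "biunique (rel_of x)" by (rule bx)
  show "\<exists>y\<in>carrier fraction_monoid. rel_of y = (rel_of x)\<inverse>"
    using fractional_converse[OF fx] biunique_converse[OF bx] encode(2) encode_closed by blast
  show "\<exists>y\<in>carrier fraction_monoid. rel_of x \<inter> rel_of y = {} \<and>
      rel_of x \<union> rel_of y = rel_of \<one>\<^bsub>fraction_monoid\<^esub>" if "rel_of x \<subseteq> Id"
  proof -
    \<comment> \<open>A partial identity in \<open>T\<close> comes from a projection, so its
      complement is that of the projection in \<open>M\<close>.\<close>
    obtain e where e: "e \<in> projections" "rel_of x = act e"
      using fractional_subset_Id[OF fx \<open>rel_of x \<subseteq> Id\<close>] by blast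
    obtain f where f: "f \<in> projections" "e \<otimes> f = zero" "is_join M star {e, f} \<one>"
      using projection_complement_ex[OF e(1)] by blast
    have "act e O act f = {}" using act_mult[of e f] e(1) f act_zero by simp
    then have "act e \<inter> act f = {}"
      using act_projection_subset_Id[OF e(1)] act_projection_subset_Id[OF f(1)] by blast
    then show ?thesis
      using act_join[OF e(1) f(1,3)] e(2) encode_act[of f] encode_act[of \<one>] f(1)
      by (intro bexI[of _ "encode (act f)"]) (simp_all add: one_fraction_monoid)
  qed
  fix y assume y: "y \<in> carrier fraction_monoid"
  then have fy: "fractional (rel_of y)" by (auto elim!: fraction_monoidE)
  show "x \<otimes>\<^bsub>fraction_monoid\<^esub> y \<in> carrier fraction_monoid"
    "rel_of (x \<otimes>\<^bsub>fraction_monoid\<^esub> y) = rel_of x O rel_of y"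
    using rel_of_mult x y by auto
  show "\<exists>z\<in>carrier fraction_monoid. rel_of z = rel_of x \<union> rel_of y" if "biunique (rel_of x \<union> rel_of y)"
    using fractional_Un[OF fx fy] that encode(2) encode_closed by blast
  fix z assume z: "z \<in> carrier fraction_monoid"
  show "x \<otimes>\<^bsub>fraction_monoid\<^esub> y \<otimes>\<^bsub>fraction_monoid\<^esub> z = x \<otimes>\<^bsub>fraction_monoid\<^esub> (y \<otimes>\<^bsub>fraction_monoid\<^esub> z)"
    using x y z by (auto intro!: eqI simp: rel_of_mult O_assoc)
next
  show "\<one>\<^bsub>fraction_monoid\<^esub> \<in> carrier fraction_monoid" using encode_act[of \<one>] by (simp add: one_fraction_monoid)
  show "inj_on rel_of (carrier fraction_monoid)" by (rule inj_rel_of)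
  have "biunique ({} :: ('a \<times> 'a \<times> 'a set) set rel)" by (rule biuniqueI) auto
  then show "encode {} \<in> carrier fraction_monoid" by (rule encode_closed[OF fractional_empty])
  show "rel_of (encode {}) = {}" by (rule encode(2)[OF fractional_empty])
qed

theorem fraction_monoid_embedding:
  defines "\<iota> \<equiv> \<lambda>s. encode (act s)"
  shows "\<iota> \<in> hom M fraction_monoid" "\<iota> \<one> = \<one>\<^bsub>fraction_monoid\<^esub>" "inj_on \<iota> (carrier M)"
    and "idempotents fraction_monoid \<subseteq> \<iota> ` carrier M"
proof -
  have eqI: "x = y" if "rel_of x = rel_of y" "x \<in> carrier fraction_monoid" "y \<in> carrier fraction_monoid" for x y
    using that inj_onD[OF inj_rel_of] by blast
  show "\<iota> \<in> hom M fraction_monoid"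
  proof (rule homI)
    fix s t assume s: "s \<in> carrier M" and t: "t \<in> carrier M"
    have "rel_of (\<iota> (s \<otimes> t)) = rel_of (\<iota> s \<otimes>\<^bsub>fraction_monoid\<^esub> \<iota> t)"
      unfolding \<iota>_def
      using encode_act[of "s \<otimes> t"] encode_act[of s] encode_act[of t] rel_of_mult act_mult s t by simp
    then show "\<iota> (s \<otimes> t) = \<iota> s \<otimes>\<^bsub>fraction_monoid\<^esub> \<iota> t"
      using encode_act(1)[of "s \<otimes> t"] encode_act(1)[of s] encode_act(1)[of t] rel_of_mult(1) s t
      unfolding \<iota>_def by (intro eqI) simp_all
  qed (simp add: \<iota>_def encode_act)
  show "\<iota> \<one> = \<one>\<^bsub>fraction_monoid\<^esub>" unfolding \<iota>_def by (simp add: one_fraction_monoid)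
  show "inj_on \<iota> (carrier M)"
    unfolding \<iota>_def by (rule inj_onI) (metis act_inj encode_act(2))
  show "idempotents fraction_monoid \<subseteq> \<iota> ` carrier M"
  proof
    fix x assume "x \<in> idempotents fraction_monoid"
    then have x: "x \<in> carrier fraction_monoid" "rel_of x \<subseteq> Id"
      using fraction.rep_subset_IdI unfolding idempotents_def by auto
    then obtain e where e: "e \<in> projections" "rel_of x = act e"
      using fractional_subset_Id by (metis fraction_monoidE)
    then have "x = \<iota> e" unfolding \<iota>_def using encode_act[of e] x by (auto intro: eqI)
    then show "x \<in> \<iota> ` carrier M" using e by auto
  qed
qed

text \<open>The list \<open>t\<close> is itself the decomposition. The zero is
  \<open>encode {}\<close>, a chosen list that may differ from \<open>[]\<close>; still
  \<open>[]\<close> describes the empty relation, so a nonzero \<open>t\<close> has positive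
  length.\<close>

theorem fraction_monoid_join:
  assumes t: "t \<in> carrier fraction_monoid" "t \<noteq> encode {}"
  shows "\<exists>n\<ge>1. \<exists>(a :: nat \<Rightarrow> 'a) b. (\<forall>i<n. a i \<in> carrier M \<and> b i \<in> carrier M) \<and>
    is_join fraction_monoid (inv_star fraction_monoid)
      {sg_inv fraction_monoid (encode (act (a i))) \<otimes>\<^bsub>fraction_monoid\<^esub> encode (act (b i)) | i. i < n} t"
proof -
  define a where "a i = fst (t ! i)" for i
  define b where "b i = snd (t ! i)" for i
  let ?q = "\<lambda>i. sg_inv fraction_monoid (encode (act (a i))) \<otimes>\<^bsub>fraction_monoid\<^esub> encode (act (b i))"
  have "set t \<subseteq> carrier M \<times> carrier M" using t(1) by (rule fraction_monoidE)
  then have ab: "a i \<in> carrier M" "b i \<in> carrier M" if "i < length t" for i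
    using that unfolding a_def b_def by (metis mem_Times_iff nth_mem subsetD)+
  have q: "?q i \<in> carrier fraction_monoid" "rel_of (?q i) = (act (a i))\<inverse> O act (b i)"
    if "i < length t" for i
    using ab[OF that] fraction.sg_inv_rep rel_of_mult encode_act by simp_all
  have "set t = (\<lambda>i. t ! i) ` {..<length t}" by (auto simp: set_conv_nth)
  then have "rel_of t = (\<Union>i<length t. (act (a i))\<inverse> O act (b i))"
    unfolding rel_of_def a_def b_def by (auto simp: case_prod_beta)
  also have "\<dots> = (\<Union>x\<in>{?q i | i. i < length t}. rel_of x)" using q(2) by auto
  finally have "is_join fraction_monoid (inv_star fraction_monoid) {?q i | i. i < length t} t"
    using q(1) t(1) by (intro fraction.is_join_rep) auto
  moreover have "t \<noteq> []"
  proof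
    assume "t = []"
    then have "rel_of t = {}" by (simp add: rel_of_def)
    then show False using t by (metis fraction_monoidE)
  qed
  ultimately show ?thesis
    using ab by (intro exI[of _ "length t"] conjI exI[of _ a] exI[of _ b]) (auto simp: Suc_le_eq)
qed

end

theorem theorem4p4:
  fixes S :: "('a, 'm) monoid_scheme" (structure)
    and star pls :: "'a \<Rightarrow> 'a" and zero :: 'a
  assumes "boolean_ample_monoid S star pls zero"
    and "\<And>F a b. \<lbrakk>prime_filter (natural_order_on S star (idempotents S)) F;
            a \<in> carrier S; b \<in> carrier S; star a \<otimes> star b \<in> F\<rbrakk> \<Longrightarrow>
          \<exists>c\<in>carrier S. \<exists>d\<in>carrier S. c \<noteq> zero \<and> d \<noteq> zero \<and>
            (\<exists>a1\<in>carrier S. a1 \<sqsubseteq>\<^bsub>natural_order S star\<^esub> a \<and> star a1 \<in> F \<and> star a \<in> F \<and>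
               pls a1 \<sqsubseteq>\<^bsub>natural_order S star\<^esub> star c) \<and>
            (\<exists>b1\<in>carrier S. b1 \<sqsubseteq>\<^bsub>natural_order S star\<^esub> b \<and> star b1 \<in> F \<and> star b \<in> F \<and>
               pls b1 \<sqsubseteq>\<^bsub>natural_order S star\<^esub> star d) \<and>
            (\<exists>e\<in>F. c \<otimes> a \<otimes> e = d \<otimes> b \<otimes> e)"
  shows "\<exists>(T :: ('a \<times> 'a) list monoid) zeroT \<iota>.
           boolean_inverse_monoid T zeroT \<and>
           \<iota> \<in> hom S T \<and> \<iota> \<one> = \<one>\<^bsub>T\<^esub> \<and> inj_on \<iota> (carrier S) \<and>
           idempotents T \<subseteq> \<iota> ` carrier S \<and>
           (\<forall>t\<in>carrier T. t \<noteq> zeroT \<longrightarrow>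
              (\<exists>n\<ge>1. \<exists>(a :: nat \<Rightarrow> 'a) (b :: nat \<Rightarrow> 'a).
                 (\<forall>i<n. a i \<in> carrier S \<and> b i \<in> carrier S) \<and>
                 is_join T (inv_star T)
                   {sg_inv T (\<iota> (a i)) \<otimes>\<^bsub>T\<^esub> \<iota> (b i) | i. i < n} t))"
proof -
  interpret boolean_ample_monoid S star pls zero by (rule assms(1))
  interpret ore_boolean_ample_monoid S star pls zero
  proof
    fix F a b assume F: "prime F" and a: "a \<in> carrier S" and b: "b \<in> carrier S"
      and stars: "star a \<in> F" "star b \<in> F"
    have "star a \<otimes> star b \<in> F" using primeD(4)[OF F] a b stars by simp
    then obtain c d a1 e where c: "c \<in> carrier S" and d: "d \<in> carrier S" and a1: "a1 \<in> carrier S"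
      and a1_le: "a1 \<sqsubseteq>\<^bsub>natural_order S star\<^esub> a" "star a1 \<in> F" "pls a1 \<sqsubseteq>\<^bsub>natural_order S star\<^esub> star c"
      and e: "e \<in> F" "c \<otimes> a \<otimes> e = d \<otimes> b \<otimes> e"
      using assms(2)[of F a b] prime_filter_if_prime[OF F] a b
      unfolding idempotents_eq_projections by blast
    have le: "a1 = a \<otimes> star a1" "pls a1 = star c \<otimes> pls a1"
      using a1_le a1 unfolding natural_order_def by simp_all
    \<comment> \<open>Condition (1) ensures that \<open>c \<otimes> a\<close> does not vanish at
      \<open>F\<close>: computing \<open>star (c \<otimes> a1)\<close> in two ways puts
      \<open>star a1 \<in> F\<close> below \<open>star (c \<otimes> a)\<close>.\<close>
    have "star c \<otimes> a1 = a1"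
      using le(2) A4(2)[OF a1] c a1 by (metis m_assoc pls_closed star_closed)
    then have "star (c \<otimes> a1) = star a1" using A5(1)[OF c a1] by simp
    moreover have "star (c \<otimes> a1) = star (c \<otimes> a) \<otimes> star a1"
      using star_mult_projection[of "c \<otimes> a" "star a1"] le(1) a a1 c by (metis m_assoc m_closed star_closed star_projection)
    ultimately have "star (c \<otimes> a) \<in> F"
      using prime_upward[OF F a1_le(2)] a c by simp
    moreover have ep: "e \<in> projections" using primeD(1)[OF F e(1)] .
    ultimately have cae: "star (c \<otimes> a \<otimes> e) \<in> F"
      using star_mult_projection[of "c \<otimes> a" e] primeD(4)[OF F] e(1) a c by simp
    \<comment> \<open>The restriction to \<open>e\<close> stands to the right of \<open>a\<close>
      and \<open>b\<close>; by (A6) it moves to the far left, where the multipliers absorb it and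
      the Ore equation becomes exact.\<close>
    let ?c = "pls (c \<otimes> a \<otimes> e) \<otimes> c" and ?d = "pls (d \<otimes> b \<otimes> e) \<otimes> d"
    have "?c \<otimes> a = c \<otimes> a \<otimes> e" "?d \<otimes> b = d \<otimes> b \<otimes> e"
      using projection_slide_left[of "c \<otimes> a" e] projection_slide_left[of "d \<otimes> b" e] a b c d ep
      by (simp_all add: m_assoc)
    then show "\<exists>c\<in>carrier S. \<exists>d\<in>carrier S. c \<otimes> a = d \<otimes> b \<and> star (c \<otimes> a) \<in> F"
      using cae e(2) a b c d ep by (intro bexI[of _ ?c] bexI[of _ ?d]) auto
  qed
  show ?thesis
    using fraction.boolean_inverse_monoid_axioms fraction_monoid_embedding fraction_monoid_join
    by (intro exI[of _ fraction_monoid] exI[of _ "encode {}"] exI[of _ "\<lambda>s. encode (act s)"]) blast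
qed

end
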